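(* Let $A$ be an artin algebra. Every connected component of the $\mho$-quiver of $A$ is a linearly oriented quiver $\mathbb A_n$ with $n\ge1$ vertices, or an oriented cycle $\widetilde{\mathbb A}_n$ with $n+1\ge1$ vertices, or of the form $-\mathbb N$, or $\mathbb N$, or $\mathbb Z$.
   Context: Modules are finitely generated left $A$-modules. $\operatorname{add}(A)$ is the class of projective modules. A left $\operatorname{add}(A)$-approximation of $M$ is a map $\omega\colon M\to P$ with $P$ projective such that every map from $M$ to a projective module factors through $\omega$; it is minimal if every $h\colon P\to P$ with $h\omega=\omega$ is an automorphism. $\mho M$ is the cokernel of a minimal left $\operatorname{add}(A)$-approximation of $M$. A module is torsionless if it is a submodule of a projective module. If $X$ is indecomposable, non-projective and torsionless, then $\mho X$ is indecomposable and non-projective. The $\mho$-quiver of $A$ has as vertices the isomorphism classes $[X]$ of indecomposable non-projective modules $X$, and there is one arrow $[\mho X]\to[X]$ (starting at $[\mho X]$, ending at $[X]$) for every torsionless indecomposable non-projective module $X$; there are no other arrows. A subset $I\subseteq\mathbb Z$ is regarded as a quiver with an arrow from $z$ to $z-1$ whenever $z-1,z\in I$; thus $\mathbb A_n=\{1,\dots,n\}$ linearly oriented, $\mathbb N=\{0,1,2,\dots\}$ has a unique sink and no source, and $-\mathbb N$ has a unique source and no sink. *)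

theory Defs
  imports
    "Graph_Theory.Digraph_Isomorphism"
    "HOL-Algebra.Module"
    "HOL-Algebra.Ideal"
begin

section \<open>Left modules over a ring\<close>

text \<open>The locale \<^locale>\<open>module\<close> of the library requires a commutative ring of scalars. The
  following is the same notion over an arbitrary ring. As there, the fields \<^term>\<open>mult\<close> and
  \<^term>\<open>one\<close> of the record that carries the module are irrelevant. The library predicate
  \<^locale>\<open>submodule\<close> does not refer to commutativity and is used as it stands.\<close>

locale left_module = A?: ring A + M?: abelian_group M
  for A :: "('a, 'k) ring_scheme" (structure) and M :: "('a, 'm, 'l) module_scheme" (structure) +
  assumes smult_closed [simp, intro]:
      "\<lbrakk>a \<in> carrier A; x \<in> carrier M\<rbrakk> \<Longrightarrow> a \<odot>\<^bsub>M\<^esub> x \<in> carrier M"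
    and smult_l_distr:
      "\<lbrakk>a \<in> carrier A; b \<in> carrier A; x \<in> carrier M\<rbrakk> \<Longrightarrow>
        (a \<oplus>\<^bsub>A\<^esub> b) \<odot>\<^bsub>M\<^esub> x = a \<odot>\<^bsub>M\<^esub> x \<oplus>\<^bsub>M\<^esub> b \<odot>\<^bsub>M\<^esub> x"
    and smult_r_distr:
      "\<lbrakk>a \<in> carrier A; x \<in> carrier M; y \<in> carrier M\<rbrakk> \<Longrightarrow>
        a \<odot>\<^bsub>M\<^esub> (x \<oplus>\<^bsub>M\<^esub> y) = a \<odot>\<^bsub>M\<^esub> x \<oplus>\<^bsub>M\<^esub> a \<odot>\<^bsub>M\<^esub> y"
    and smult_assoc:
      "\<lbrakk>a \<in> carrier A; b \<in> carrier A; x \<in> carrier M\<rbrakk> \<Longrightarrow>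
        (a \<otimes>\<^bsub>A\<^esub> b) \<odot>\<^bsub>M\<^esub> x = a \<odot>\<^bsub>M\<^esub> (b \<odot>\<^bsub>M\<^esub> x)"
    and smult_one [simp]:
      "x \<in> carrier M \<Longrightarrow> \<one>\<^bsub>A\<^esub> \<odot>\<^bsub>M\<^esub> x = x"

definition finitely_generated ::
    "('a, 'k) ring_scheme \<Rightarrow> ('a, 'm, 'l) module_scheme \<Rightarrow> bool" where
  "finitely_generated A M \<longleftrightarrow>
    (\<exists>S. finite S \<and> S \<subseteq> carrier M \<and> (\<forall>U. submodule U A M \<and> S \<subseteq> U \<longrightarrow> U = carrier M))"

definition module_hom ::
    "('a, 'k) ring_scheme \<Rightarrow> ('a, 'm, 'l) module_scheme \<Rightarrow> ('a, 'n, 'h) module_scheme \<Rightarrow> ('m \<Rightarrow> 'n) set"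
  where
  "module_hom A M N =
    {f \<in> carrier M \<rightarrow> carrier N.
      (\<forall>x\<in>carrier M. \<forall>y\<in>carrier M. f (x \<oplus>\<^bsub>M\<^esub> y) = f x \<oplus>\<^bsub>N\<^esub> f y) \<and>
      (\<forall>a\<in>carrier A. \<forall>x\<in>carrier M. f (a \<odot>\<^bsub>M\<^esub> x) = a \<odot>\<^bsub>N\<^esub> f x)}"

definition module_iso ::
    "('a, 'k) ring_scheme \<Rightarrow> ('a, 'm, 'l) module_scheme \<Rightarrow> ('a, 'n, 'h) module_scheme \<Rightarrow> ('m \<Rightarrow> 'n) set"
  where
  "module_iso A M N = {f \<in> module_hom A M N. bij_betw f (carrier M) (carrier N)}"

definition module_isomorphic ::
    "('a, 'k) ring_scheme \<Rightarrow> ('a, 'm, 'l) module_scheme \<Rightarrow> ('a, 'n, 'h) module_scheme \<Rightarrow> bool"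
  where
  "module_isomorphic A M N \<longleftrightarrow> module_iso A M N \<noteq> {}"

text \<open>The quotient of \<open>M\<close> by a submodule \<open>U\<close>, on the set of cosets of \<open>U\<close>; the values of
  \<^term>\<open>mult\<close> and \<^term>\<open>one\<close> are irrelevant.\<close>

definition quotient_module :: "('a, 'm, 'l) module_scheme \<Rightarrow> 'm set \<Rightarrow> ('a, 'm set) module" where
  "quotient_module M U =
    \<lparr>carrier = a_rcosets\<^bsub>M\<^esub> U, mult = (\<lambda>_ _. U), one = U, zero = U,
     add = (\<lambda>C D. C <+>\<^bsub>M\<^esub> D),
     smult = (\<lambda>a C. \<Union>x\<in>C. U +>\<^bsub>M\<^esub> (a \<odot>\<^bsub>M\<^esub> x))\<rparr>"


section \<open>Artin algebras\<close>

definition artinian_ring :: "('r, 'k) ring_scheme \<Rightarrow> bool" where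
  "artinian_ring R \<longleftrightarrow>
    (\<forall>I :: nat \<Rightarrow> 'r set. (\<forall>n. ideal (I n) R \<and> I (Suc n) \<subseteq> I n) \<longrightarrow> (\<exists>n. \<forall>m\<ge>n. I m = I n))"

text \<open>The library locale \<^locale>\<open>algebra\<close> requires a commutative algebra. Here the ring \<open>A\<close> need
  not be commutative; commutativity of \<open>R\<close> is part of \<^term>\<open>module R A\<close>.\<close>

definition artin_algebra :: "('r, 'k) ring_scheme \<Rightarrow> ('r, 'a) module \<Rightarrow> bool" where
  "artin_algebra R A \<longleftrightarrow>
    module R A \<and> ring A \<and>
    (\<forall>r\<in>carrier R. \<forall>x\<in>carrier A. \<forall>y\<in>carrier A.
      (r \<odot>\<^bsub>A\<^esub> x) \<otimes>\<^bsub>A\<^esub> y = r \<odot>\<^bsub>A\<^esub> (x \<otimes>\<^bsub>A\<^esub> y) \<and> x \<otimes>\<^bsub>A\<^esub> (r \<odot>\<^bsub>A\<^esub> y) = r \<odot>\<^bsub>A\<^esub> (x \<otimes>\<^bsub>A\<^esub> y)) \<and>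
    artinian_ring R \<and> finitely_generated R A"


section \<open>The category of finitely generated modules\<close>

text \<open>Every finitely generated left module over a ring with elements of type \<open>'a\<close> is a quotient of
  some free module of finite rank, hence is isomorphic to one whose elements are sets of sequences
  in \<open>'a\<close> (lemma \<open>fg_module_representative\<close>). Quantification over this type therefore is
  quantification over all finitely generated modules, up to isomorphism.\<close>

type_synonym 'a fgm = "('a, (nat \<Rightarrow> 'a) set) module"

definition fg_module :: "('a, 'k) ring_scheme \<Rightarrow> ('a, 'm, 'l) module_scheme \<Rightarrow> bool" where
  "fg_module A M \<longleftrightarrow> left_module A M \<and> finitely_generated A M"

lemma fg_module_transport:
  fixes A :: "('a, 'k) ring_scheme" and M :: "('a, 'm, 'l) module_scheme" and j :: "'m \<Rightarrow> 'n"
  assumes M: "fg_module A M" and j: "inj_on j (carrier M)"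
  shows "\<exists>N :: ('a, 'n) module. fg_module A N \<and> module_isomorphic A M N"
proof -
  interpret left_module A M using M by (simp add: fg_module_def)
  define i where "i = the_inv_into (carrier M) j"
  have ij [simp]: "i (j x) = x" if "x \<in> carrier M" for x
    using j that by (simp add: i_def the_inv_into_f_f)
  define N :: "('a, 'n) module" where
    "N = \<lparr>carrier = j ` carrier M, mult = undefined, one = undefined, zero = j \<zero>\<^bsub>M\<^esub>,
      add = (\<lambda>x y. j (i x \<oplus>\<^bsub>M\<^esub> i y)), smult = (\<lambda>a x. j (a \<odot>\<^bsub>M\<^esub> i x))\<rparr>"
  have N [simp]: "carrier N = j ` carrier M" "zero N = j \<zero>\<^bsub>M\<^esub>"
    "add N x y = j (i x \<oplus>\<^bsub>M\<^esub> i y)" "smult N a x = j (a \<odot>\<^bsub>M\<^esub> i x)" for a x y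
    by (simp_all add: N_def)
  have abN: "abelian_group N"
  proof (rule abelian_groupI, goal_cases)
    case (6 x)
    then obtain m where "m \<in> carrier M" "x = j m" by auto
    then show ?case by (intro bexI[of _ "j (\<ominus>\<^bsub>M\<^esub> m)"]) (auto simp: M.l_neg)
  qed (auto simp: M.a_ac)
  have lm: "left_module A N"
    by (intro left_module.intro abN A.ring_axioms left_module_axioms.intro)
       (auto simp: smult_l_distr smult_r_distr smult_assoc)
  obtain S where S: "finite S" "S \<subseteq> carrier M"
      "\<And>U. submodule U A M \<Longrightarrow> S \<subseteq> U \<Longrightarrow> U = carrier M"
    using M by (auto simp: fg_module_def finitely_generated_def)
  have "finitely_generated A N"
    unfolding finitely_generated_def
  proof (intro exI[of _ "j ` S"] conjI allI impI)
    fix U assume "submodule U A N \<and> j ` S \<subseteq> U"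
    then have U: "submodule U A N" and SU: "j ` S \<subseteq> U" by auto
    interpret N: abelian_group N by (rule abN)
    interpret U: submodule U A N by (rule U)
    have UN: "U \<subseteq> j ` carrier M" using U.subset by simp
    define V where "V = {m \<in> carrier M. j m \<in> U}"
    have "submodule V A M"
    proof (intro submodule.intro submodule_axioms.intro)
      show "subgroup V (add_monoid M)"
      proof
        show "V \<subseteq> carrier (add_monoid M)" by (auto simp: V_def)
        show "x \<otimes>\<^bsub>add_monoid M\<^esub> y \<in> V" if "x \<in> V" "y \<in> V" for x y
          using that U.m_closed[of "j x" "j y"] by (simp add: V_def)
        show "\<one>\<^bsub>add_monoid M\<^esub> \<in> V" using U.one_closed by (simp add: V_def)
        show "inv\<^bsub>add_monoid M\<^esub> x \<in> V" if "x \<in> V" for x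
        proof -
          have x: "x \<in> carrier M" "j x \<in> U" using that by (auto simp: V_def)
          have "\<ominus>\<^bsub>N\<^esub> j x = j (\<ominus>\<^bsub>M\<^esub> x)"
            by (rule N.minus_equality) (use x in \<open>auto simp: M.l_neg\<close>)
          then show ?thesis using x U.m_inv_closed[of "j x"] by (auto simp: V_def a_inv_def)
        qed
      qed
      show "a \<odot>\<^bsub>M\<^esub> x \<in> V" if "a \<in> carrier A" "x \<in> V" for a x
        using that U.smult_closed[of a "j x"] by (auto simp: V_def)
    qed
    moreover have "S \<subseteq> V" using S(2) SU by (auto simp: V_def)
    ultimately have "V = carrier M" by (rule S(3))
    then show "U = carrier N" using UN by (auto simp: V_def)
  qed (use S in auto)
  moreover have "j \<in> module_iso A M N"
    using j by (auto simp: module_iso_def module_hom_def bij_betw_def)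
  ultimately show ?thesis using lm by (auto simp: fg_module_def module_isomorphic_def)
qed

lemma fg_module_representative:
  fixes A :: "('a, 'k) ring_scheme" and M :: "('a, 'm, 'l) module_scheme"
  assumes M: "fg_module A M"
  shows "\<exists>N :: 'a fgm. fg_module A N \<and> module_isomorphic A M N"
proof -
  interpret left_module A M using M by (simp add: fg_module_def)
  have null: "\<zero>\<^bsub>A\<^esub> \<odot>\<^bsub>M\<^esub> x = \<zero>\<^bsub>M\<^esub>" if "x \<in> carrier M" for x
    using smult_l_distr[of "\<zero>\<^bsub>A\<^esub>" "\<zero>\<^bsub>A\<^esub>" x] that by (simp add: M.add.l_cancel_one')
  have rnull: "a \<odot>\<^bsub>M\<^esub> \<zero>\<^bsub>M\<^esub> = \<zero>\<^bsub>M\<^esub>" if "a \<in> carrier A" for a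
    using smult_r_distr[of a "\<zero>\<^bsub>M\<^esub>" "\<zero>\<^bsub>M\<^esub>"] that by (simp add: M.add.l_cancel_one')
  obtain S where S: "finite S" "S \<subseteq> carrier M"
      "\<And>U. submodule U A M \<Longrightarrow> S \<subseteq> U \<Longrightarrow> U = carrier M"
    using M by (auto simp: fg_module_def finitely_generated_def)
  obtain n and s :: "nat \<Rightarrow> 'm" where s: "S = s ` {..<n}"
    using finite_imp_nat_seg_image_inj_on[OF S(1)] by (auto simp: lessThan_def)
  have sM: "s i \<in> carrier M" if "i < n" for i using S(2) s that by auto
  define \<phi> where "\<phi> f = (\<Oplus>\<^bsub>M\<^esub> i\<in>{..<n}. f i \<odot>\<^bsub>M\<^esub> s i)" for f :: "nat \<Rightarrow> 'a"
  define F where "F = {..<n} \<rightarrow> carrier A"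
  have \<phi>M: "\<phi> f \<in> carrier M" if "f \<in> F" for f
    using that sM unfolding \<phi>_def F_def by (intro M.finsum_closed) auto
  have \<phi>add: "\<phi> (\<lambda>i. f i \<oplus>\<^bsub>A\<^esub> g i) = \<phi> f \<oplus>\<^bsub>M\<^esub> \<phi> g" if "f \<in> F" "g \<in> F" for f g
  proof -
    have "\<phi> (\<lambda>i. f i \<oplus>\<^bsub>A\<^esub> g i) = (\<Oplus>\<^bsub>M\<^esub> i\<in>{..<n}. f i \<odot>\<^bsub>M\<^esub> s i \<oplus>\<^bsub>M\<^esub> g i \<odot>\<^bsub>M\<^esub> s i)"
      unfolding \<phi>_def using that sM
      by (intro M.finsum_cong') (auto simp: F_def smult_l_distr Pi_iff)
    then show ?thesis using that sM unfolding \<phi>_def F_def by (simp add: M.finsum_addf Pi_iff)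
  qed
  have smult_sum: "a \<odot>\<^bsub>M\<^esub> (\<Oplus>\<^bsub>M\<^esub> i\<in>I. g i) = (\<Oplus>\<^bsub>M\<^esub> i\<in>I. a \<odot>\<^bsub>M\<^esub> g i)"
    if "finite I" "a \<in> carrier A" "g \<in> I \<rightarrow> carrier M" for a g and I :: "nat set"
    using that by (induction I) (auto simp: rnull smult_r_distr Pi_iff)
  have \<phi>smult: "\<phi> (\<lambda>i. a \<otimes>\<^bsub>A\<^esub> f i) = a \<odot>\<^bsub>M\<^esub> \<phi> f" if "a \<in> carrier A" "f \<in> F" for a f
  proof -
    have "\<phi> (\<lambda>i. a \<otimes>\<^bsub>A\<^esub> f i) = (\<Oplus>\<^bsub>M\<^esub> i\<in>{..<n}. a \<odot>\<^bsub>M\<^esub> (f i \<odot>\<^bsub>M\<^esub> s i))"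
      unfolding \<phi>_def using that sM by (intro M.finsum_cong') (auto simp: F_def smult_assoc Pi_iff)
    then show ?thesis using that sM unfolding \<phi>_def F_def by (simp add: smult_sum Pi_iff)
  qed
  have "submodule (\<phi> ` F) A M"
  proof (intro submodule.intro submodule_axioms.intro)
    show "subgroup (\<phi> ` F) (add_monoid M)"
    proof (rule M.add.subgroupI)
      show "\<phi> ` F \<subseteq> carrier M" using \<phi>M by auto
      show "\<phi> ` F \<noteq> {}" by (auto simp: F_def)
      show "u \<oplus>\<^bsub>M\<^esub> v \<in> \<phi> ` F" if uv: "u \<in> \<phi> ` F" "v \<in> \<phi> ` F" for u v
      proof -
        obtain f g where fg: "f \<in> F" "g \<in> F" "u = \<phi> f" "v = \<phi> g" using uv by blast
        then have "(\<lambda>i. f i \<oplus>\<^bsub>A\<^esub> g i) \<in> F" by (auto simp: F_def)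
        then show ?thesis using fg \<phi>add[of f g] by (metis image_eqI)
      qed
      show "\<ominus>\<^bsub>M\<^esub> m \<in> \<phi> ` F" if m: "m \<in> \<phi> ` F" for m
      proof -
        obtain f where f: "f \<in> F" "m = \<phi> f" using m by auto
        define g where "g i = \<ominus>\<^bsub>A\<^esub> \<one>\<^bsub>A\<^esub> \<otimes>\<^bsub>A\<^esub> f i" for i
        have g: "g \<in> F" using f by (auto simp: F_def g_def Pi_iff intro!: A.m_closed A.a_inv_closed)
        have "\<phi> g \<oplus>\<^bsub>M\<^esub> \<phi> f = (\<ominus>\<^bsub>A\<^esub> \<one>\<^bsub>A\<^esub>) \<odot>\<^bsub>M\<^esub> \<phi> f \<oplus>\<^bsub>M\<^esub> \<one>\<^bsub>A\<^esub> \<odot>\<^bsub>M\<^esub> \<phi> f"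
          using f \<phi>M \<phi>smult[of "\<ominus>\<^bsub>A\<^esub> \<one>\<^bsub>A\<^esub>" f] by (simp add: g_def[abs_def])
        also have "\<dots> = \<zero>\<^bsub>M\<^esub>"
          using f \<phi>M by (simp add: smult_l_distr[symmetric] A.l_neg null del: smult_one)
        finally have "\<ominus>\<^bsub>M\<^esub> m = \<phi> g" using f g \<phi>M by (simp add: M.minus_equality)
        then show ?thesis using g by auto
      qed
    qed
    show "a \<odot>\<^bsub>M\<^esub> x \<in> \<phi> ` F" if a: "a \<in> carrier A" "x \<in> \<phi> ` F" for a x
    proof -
      obtain f where f: "f \<in> F" "x = \<phi> f" using a by auto
      then have "(\<lambda>i. a \<otimes>\<^bsub>A\<^esub> f i) \<in> F" using a by (auto simp: F_def)
      then show ?thesis using f a \<phi>smult[of a f] by (metis image_eqI)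
    qed
  qed
  moreover have "S \<subseteq> \<phi> ` F"
  proof
    fix x assume "x \<in> S"
    then obtain k where k: "k < n" "x = s k" using s by auto
    define e where "e i = (if k = i then \<one>\<^bsub>A\<^esub> else \<zero>\<^bsub>A\<^esub>)" for i
    have "\<phi> e = (\<Oplus>\<^bsub>M\<^esub> i\<in>{..<n}. if k = i then s i else \<zero>\<^bsub>M\<^esub>)"
      unfolding \<phi>_def using sM by (intro M.finsum_cong') (auto simp: e_def null)
    also have "\<dots> = s k" using k sM by (intro M.finsum_singleton) auto
    finally show "x \<in> \<phi> ` F" using k by (auto simp: F_def e_def image_iff intro!: bexI[of _ e])
  qed
  ultimately have onto: "\<phi> ` F = carrier M" by (rule S(3))
  have "inj_on (\<lambda>m. {f \<in> F. \<phi> f = m}) (carrier M)"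
  proof (rule inj_onI)
    fix x y assume x: "x \<in> carrier M" and eq: "{f \<in> F. \<phi> f = x} = {f \<in> F. \<phi> f = y}"
    have "x \<in> \<phi> ` F" using x onto by simp
    then obtain f where "f \<in> F" "\<phi> f = x" by blast
    then have "f \<in> {f \<in> F. \<phi> f = y}" using eq by blast
    then show "x = y" using \<open>\<phi> f = x\<close> by simp
  qed
  then show ?thesis by (rule fg_module_transport[OF M])
qed

definition projective_module :: "('a, 'k) ring_scheme \<Rightarrow> 'a fgm \<Rightarrow> bool" where
  "projective_module A P \<longleftrightarrow> fg_module A P \<and>
    (\<forall>(M :: 'a fgm) (N :: 'a fgm) g f.
      fg_module A M \<and> fg_module A N \<and>
      g \<in> module_hom A M N \<and> g ` carrier M = carrier N \<and> f \<in> module_hom A P N \<longrightarrow>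
      (\<exists>h \<in> module_hom A P M. \<forall>x\<in>carrier P. g (h x) = f x))"

text \<open>Being a submodule of a projective module is understood up to isomorphism, as an embedding.\<close>

definition torsionless :: "('a, 'k) ring_scheme \<Rightarrow> 'a fgm \<Rightarrow> bool" where
  "torsionless A M \<longleftrightarrow> fg_module A M \<and>
    (\<exists>P f. projective_module A P \<and> f \<in> module_hom A M P \<and> inj_on f (carrier M))"

definition indecomposable_module :: "('a, 'k) ring_scheme \<Rightarrow> 'a fgm \<Rightarrow> bool" where
  "indecomposable_module A M \<longleftrightarrow> fg_module A M \<and> carrier M \<noteq> {\<zero>\<^bsub>M\<^esub>} \<and>
    (\<forall>U V. submodule U A M \<and> submodule V A M \<and>
      U <+>\<^bsub>M\<^esub> V = carrier M \<and> U \<inter> V = {\<zero>\<^bsub>M\<^esub>} \<longrightarrow> U = {\<zero>\<^bsub>M\<^esub>} \<or> V = {\<zero>\<^bsub>M\<^esub>})"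

definition left_add_approximation ::
    "('a, 'k) ring_scheme \<Rightarrow> 'a fgm \<Rightarrow> 'a fgm \<Rightarrow> ((nat \<Rightarrow> 'a) set \<Rightarrow> (nat \<Rightarrow> 'a) set) \<Rightarrow> bool"
  where
  "left_add_approximation A M P \<omega> \<longleftrightarrow>
    projective_module A P \<and> \<omega> \<in> module_hom A M P \<and>
    (\<forall>Q f. projective_module A Q \<and> f \<in> module_hom A M Q \<longrightarrow>
      (\<exists>g \<in> module_hom A P Q. \<forall>x\<in>carrier M. g (\<omega> x) = f x))"

definition minimal_left_add_approximation ::
    "('a, 'k) ring_scheme \<Rightarrow> 'a fgm \<Rightarrow> 'a fgm \<Rightarrow> ((nat \<Rightarrow> 'a) set \<Rightarrow> (nat \<Rightarrow> 'a) set) \<Rightarrow> bool"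
  where
  "minimal_left_add_approximation A M P \<omega> \<longleftrightarrow>
    left_add_approximation A M P \<omega> \<and>
    (\<forall>h \<in> module_hom A P P. (\<forall>x\<in>carrier M. h (\<omega> x) = \<omega> x) \<longrightarrow> h \<in> module_iso A P P)"

text \<open>\<open>is_mho A M Y\<close> means \<open>Y \<cong> \<mho>M\<close>; the module \<open>\<mho>M\<close> is only defined up to isomorphism.\<close>

definition is_mho :: "('a, 'k) ring_scheme \<Rightarrow> 'a fgm \<Rightarrow> 'a fgm \<Rightarrow> bool" where
  "is_mho A M Y \<longleftrightarrow> fg_module A Y \<and>
    (\<exists>P \<omega>. minimal_left_add_approximation A M P \<omega> \<and>
      module_isomorphic A (quotient_module P (\<omega> ` carrier M)) Y)"


section \<open>Quivers\<close>

definition iso_class :: "('a, 'k) ring_scheme \<Rightarrow> 'a fgm \<Rightarrow> 'a fgm set" where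
  "iso_class A X = {Y. fg_module A Y \<and> module_isomorphic A X Y}"

text \<open>An arrow is encoded as the pair of its tail \<open>[\<mho>X]\<close> and its head \<open>[X]\<close>. Since \<open>[\<mho>X]\<close> is
  determined by \<open>[X]\<close>, this is one arrow for every torsionless vertex \<open>[X]\<close>.\<close>

definition mho_quiver ::
    "('a, 'k) ring_scheme \<Rightarrow> ('a fgm set, 'a fgm set \<times> 'a fgm set) pre_digraph" where
  "mho_quiver A =
    \<lparr>verts = {iso_class A X | X. indecomposable_module A X \<and> \<not> projective_module A X},
     arcs = {(iso_class A Y, iso_class A X) | X Y.
       indecomposable_module A X \<and> \<not> projective_module A X \<and> torsionless A X \<and> is_mho A X Y},
     tail = fst, head = snd\<rparr>"

text \<open>In \<^term>\<open>int_quiver I\<close> the arrow from \<open>z\<close> to \<open>z - 1\<close> is labelled by its tail \<open>z\<close>.\<close>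

definition int_quiver :: "int set \<Rightarrow> (int, int) pre_digraph" where
  "int_quiver I = \<lparr>verts = I, arcs = {z \<in> I. z - 1 \<in> I}, tail = (\<lambda>z. z), head = (\<lambda>z. z - 1)\<rparr>"

text \<open>The oriented cycle with \<open>n + 1\<close> vertices and \<open>n + 1\<close> arrows; for \<open>n = 0\<close> it is a loop.\<close>

definition cycle_quiver :: "nat \<Rightarrow> (nat, nat) pre_digraph" where
  "cycle_quiver n =
    \<lparr>verts = {0..n}, arcs = {0..n}, tail = (\<lambda>i. i), head = (\<lambda>i. (i + 1) mod (n + 1))\<rparr>"

text \<open>The library predicate \<^term>\<open>connected\<close> on digraphs disregards the orientation of arcs and
  excludes the empty digraph.\<close>

definition connected_component :: "('v, 'e) pre_digraph \<Rightarrow> ('v, 'e) pre_digraph \<Rightarrow> bool" where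
  "connected_component G C \<longleftrightarrow> pre_digraph.max_subgraph G connected C"

end

theory Submission
  imports Defs
begin

text \<open>
  A connected quiver in which every vertex is the head of at most one arrow and the tail of at most
  one arrow is an oriented cycle or an interval in \<open>\<int>\<close>: starting from any vertex, one can only follow
  the arrows forwards and backwards, and the walk either closes up or never visits a vertex twice.
  The latter case is \<open>acyclic_digraph_iso_int_quiver\<close>, the former is
  \<open>cyclic_digraph_iso_cycle_quiver\<close>. So the theorem says that \<open>X\<close> determines \<open>\<mho>X\<close>, and that \<open>\<mho>X\<close>
  determines \<open>X\<close> when \<open>X\<close> is indecomposable, torsionless and not projective.

  The first claim is the uniqueness of minimal approximations (\<open>mho_isomorphic\<close>). For the second
  (\<open>isomorphic_if_mho_isomorphic\<close>), the approximation \<open>\<omega>: X \<rightarrow> P\<close> is injective because \<open>X\<close> is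
  torsionless, so there is an exact sequence \<open>0 \<rightarrow> X \<rightarrow> P \<rightarrow> \<mho>X \<rightarrow> 0\<close>, and similarly for \<open>X'\<close>. An
  isomorphism \<open>\<mho>X \<cong> \<mho>X'\<close> and its inverse lift to the middle terms and restrict to maps
  \<open>u: X \<rightarrow> X'\<close> and \<open>u': X' \<rightarrow> X\<close>. The lift of the identity of \<open>\<mho>X\<close> that arises as a composite
  differs from the identity of \<open>P\<close> by a map into \<open>X\<close>, hence \<open>u' u - 1\<close> factors through the
  projective module \<open>P\<close>. Since \<open>X\<close> is not a direct summand of \<open>P\<close>, this difference is not bijective,
  and as the endomorphism ring of \<open>X\<close> is local, \<open>u' u\<close> is bijective. By symmetry so is \<open>u u'\<close>.

  Locality comes from Fitting's lemma (\<open>endomorphism_nilpotent_or_bij\<close>), and this is where the artin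
  algebra enters. The proof given here uses the descending chain condition only: for an endomorphism
  \<open>f\<close> of a finitely generated module, a descending chain of submodules over the artinian ground ring
  \<open>R\<close> yields an equation \<open>f^n = f^(n+1) b\<close> with some \<open>b\<close> that commutes with \<open>f\<close>.
\<close>

section \<open>Homomorphisms of left modules\<close>

lemma module_homI:
  assumes "\<And>x. x \<in> carrier M \<Longrightarrow> f x \<in> carrier N"
    and "\<And>x y. \<lbrakk>x \<in> carrier M; y \<in> carrier M\<rbrakk> \<Longrightarrow> f (x \<oplus>\<^bsub>M\<^esub> y) = f x \<oplus>\<^bsub>N\<^esub> f y"
    and "\<And>a x. \<lbrakk>a \<in> carrier A; x \<in> carrier M\<rbrakk> \<Longrightarrow> f (a \<odot>\<^bsub>M\<^esub> x) = a \<odot>\<^bsub>N\<^esub> f x"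
  shows "f \<in> module_hom A M N"
  using assms by (auto simp: module_hom_def)

lemma module_hom_closed: "\<lbrakk>f \<in> module_hom A M N; x \<in> carrier M\<rbrakk> \<Longrightarrow> f x \<in> carrier N"
  and module_hom_add:
    "\<lbrakk>f \<in> module_hom A M N; x \<in> carrier M; y \<in> carrier M\<rbrakk> \<Longrightarrow> f (x \<oplus>\<^bsub>M\<^esub> y) = f x \<oplus>\<^bsub>N\<^esub> f y"
  and module_hom_smult:
    "\<lbrakk>f \<in> module_hom A M N; a \<in> carrier A; x \<in> carrier M\<rbrakk> \<Longrightarrow> f (a \<odot>\<^bsub>M\<^esub> x) = a \<odot>\<^bsub>N\<^esub> f x"
  by (auto simp: module_hom_def)

lemma module_hom_comp:
  "\<lbrakk>f \<in> module_hom A M N; g \<in> module_hom A N L\<rbrakk> \<Longrightarrow> (\<lambda>x. g (f x)) \<in> module_hom A M L"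
  by (auto simp: module_hom_def Pi_iff)

lemma module_hom_id: "(\<lambda>x. x) \<in> module_hom A M M"
  by (auto simp: module_hom_def)

lemma module_hom_funpow: "f \<in> module_hom A M M \<Longrightarrow> (f ^^ n) \<in> module_hom A M M"
  by (induction n) (auto simp: module_hom_def Pi_iff)

context left_module
begin

lemma smult_l_null: "x \<in> carrier M \<Longrightarrow> \<zero>\<^bsub>A\<^esub> \<odot>\<^bsub>M\<^esub> x = \<zero>\<^bsub>M\<^esub>"
  using smult_l_distr[of "\<zero>\<^bsub>A\<^esub>" "\<zero>\<^bsub>A\<^esub>" x] by (simp add: M.add.l_cancel_one')

lemma smult_r_null: "a \<in> carrier A \<Longrightarrow> a \<odot>\<^bsub>M\<^esub> \<zero>\<^bsub>M\<^esub> = \<zero>\<^bsub>M\<^esub>"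
  using smult_r_distr[of a "\<zero>\<^bsub>M\<^esub>" "\<zero>\<^bsub>M\<^esub>"] by (simp add: M.add.l_cancel_one')

lemma smult_minus_one:
  assumes "x \<in> carrier M" shows "(\<ominus>\<^bsub>A\<^esub> \<one>\<^bsub>A\<^esub>) \<odot>\<^bsub>M\<^esub> x = \<ominus>\<^bsub>M\<^esub> x"
proof -
  have "(\<ominus>\<^bsub>A\<^esub> \<one>\<^bsub>A\<^esub>) \<odot>\<^bsub>M\<^esub> x \<oplus>\<^bsub>M\<^esub> \<one>\<^bsub>A\<^esub> \<odot>\<^bsub>M\<^esub> x = \<zero>\<^bsub>M\<^esub>"
    using assms by (simp add: smult_l_distr[symmetric] A.l_neg smult_l_null del: smult_one)
  then have "\<ominus>\<^bsub>M\<^esub> x = (\<ominus>\<^bsub>A\<^esub> \<one>\<^bsub>A\<^esub>) \<odot>\<^bsub>M\<^esub> x"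
    by (intro M.minus_equality) (use assms in auto)
  then show ?thesis by simp
qed

lemma smult_r_minus:
  assumes "a \<in> carrier A" "x \<in> carrier M" shows "a \<odot>\<^bsub>M\<^esub> (\<ominus>\<^bsub>M\<^esub> x) = \<ominus>\<^bsub>M\<^esub> (a \<odot>\<^bsub>M\<^esub> x)"
proof -
  have "a \<odot>\<^bsub>M\<^esub> (\<ominus>\<^bsub>M\<^esub> x) \<oplus>\<^bsub>M\<^esub> a \<odot>\<^bsub>M\<^esub> x = \<zero>\<^bsub>M\<^esub>"
    using assms by (simp add: smult_r_distr[symmetric] M.l_neg smult_r_null)
  then show ?thesis using assms by (metis M.minus_equality M.a_inv_closed smult_closed)
qed

lemma submoduleI:
  assumes sub: "W \<subseteq> carrier M" and zero: "\<zero>\<^bsub>M\<^esub> \<in> W"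
    and add: "\<And>x y. \<lbrakk>x \<in> W; y \<in> W\<rbrakk> \<Longrightarrow> x \<oplus>\<^bsub>M\<^esub> y \<in> W"
    and smult: "\<And>a x. \<lbrakk>a \<in> carrier A; x \<in> W\<rbrakk> \<Longrightarrow> a \<odot>\<^bsub>M\<^esub> x \<in> W"
  shows "submodule W A M"
proof (intro submodule.intro submodule_axioms.intro)
  show "subgroup W (add_monoid M)"
  proof (rule M.add.subgroupI)
    show "\<ominus>\<^bsub>M\<^esub> x \<in> W" if "x \<in> W" for x
      using smult[of "\<ominus>\<^bsub>A\<^esub> \<one>\<^bsub>A\<^esub>" x] that sub by (simp add: smult_minus_one subset_iff)
  qed (use sub zero add in auto)
qed (rule smult)

lemma submoduleD:
  assumes "submodule W A M"
  shows "W \<subseteq> carrier M" "\<zero>\<^bsub>M\<^esub> \<in> W"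
    and "\<And>x y. \<lbrakk>x \<in> W; y \<in> W\<rbrakk> \<Longrightarrow> x \<oplus>\<^bsub>M\<^esub> y \<in> W"
    and "\<And>a x. \<lbrakk>a \<in> carrier A; x \<in> W\<rbrakk> \<Longrightarrow> a \<odot>\<^bsub>M\<^esub> x \<in> W"
    and "\<And>x y. \<lbrakk>x \<in> W; y \<in> W\<rbrakk> \<Longrightarrow> x \<ominus>\<^bsub>M\<^esub> y \<in> W"
proof -
  interpret W: submodule W A M by (rule assms)
  show sub: "W \<subseteq> carrier M" using W.subset by simp
  show "\<zero>\<^bsub>M\<^esub> \<in> W" using W.one_closed by simp
  show add: "x \<oplus>\<^bsub>M\<^esub> y \<in> W" if "x \<in> W" "y \<in> W" for x y
    using W.m_closed[OF that] by simp
  show smult: "a \<odot>\<^bsub>M\<^esub> x \<in> W" if "a \<in> carrier A" "x \<in> W" for a x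
    by (rule W.smult_closed[OF that])
  show "x \<ominus>\<^bsub>M\<^esub> y \<in> W" if "x \<in> W" "y \<in> W" for x y
    using add[OF that(1) smult[of "\<ominus>\<^bsub>A\<^esub> \<one>\<^bsub>A\<^esub>" y]] that sub
    by (simp add: smult_minus_one subset_iff M.minus_eq)
qed

lemma minus_eq_zero_iff:
  assumes "x \<in> carrier M" "y \<in> carrier M"
  shows "x \<ominus>\<^bsub>M\<^esub> y = \<zero>\<^bsub>M\<^esub> \<longleftrightarrow> x = y"
  using assms by (metis M.minus_eq M.r_neg M.minus_equality M.minus_minus M.a_inv_closed)

lemma minus_add_cancel:
  assumes "x \<in> carrier M" "y \<in> carrier M"
  shows "(x \<ominus>\<^bsub>M\<^esub> y) \<oplus>\<^bsub>M\<^esub> y = x"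
  using assms by (simp add: M.minus_eq M.a_assoc M.l_neg)

end

lemma module_hom_zero:
  assumes "left_module A M" "left_module A N" "f \<in> module_hom A M N"
  shows "f \<zero>\<^bsub>M\<^esub> = \<zero>\<^bsub>N\<^esub>"
proof -
  interpret M: left_module A M by fact
  interpret N: left_module A N by fact
  show ?thesis
    using module_hom_add[OF assms(3), of "\<zero>\<^bsub>M\<^esub>" "\<zero>\<^bsub>M\<^esub>"] module_hom_closed[OF assms(3), of "\<zero>\<^bsub>M\<^esub>"]
    by (simp add: N.M.add.l_cancel_one')
qed

lemma module_hom_minus:
  assumes "left_module A M" "left_module A N" and f: "f \<in> module_hom A M N"
    and "x \<in> carrier M" "y \<in> carrier M"
  shows "f (x \<ominus>\<^bsub>M\<^esub> y) = f x \<ominus>\<^bsub>N\<^esub> f y"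
proof -
  interpret M: left_module A M by fact
  interpret N: left_module A N by fact
  have "f (\<ominus>\<^bsub>M\<^esub> y) = \<ominus>\<^bsub>N\<^esub> f y"
    using assms module_hom_smult[OF f, of "\<ominus>\<^bsub>A\<^esub> \<one>\<^bsub>A\<^esub>" y] module_hom_closed[OF f]
    by (simp add: M.smult_minus_one N.smult_minus_one)
  then show ?thesis using assms by (simp add: M.minus_eq N.minus_eq module_hom_add[OF f])
qed

lemma module_hom_diff:
  assumes "left_module A N" and f: "f \<in> module_hom A M N" and g: "g \<in> module_hom A M N"
  shows "(\<lambda>x. f x \<ominus>\<^bsub>N\<^esub> g x) \<in> module_hom A M N"
proof -
  interpret N: left_module A N by fact
  note cl = module_hom_closed[OF f] module_hom_closed[OF g]
  show ?thesis
  proof (rule module_homI)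
    fix x y assume "x \<in> carrier M" "y \<in> carrier M"
    then show "f (x \<oplus>\<^bsub>M\<^esub> y) \<ominus>\<^bsub>N\<^esub> g (x \<oplus>\<^bsub>M\<^esub> y) = f x \<ominus>\<^bsub>N\<^esub> g x \<oplus>\<^bsub>N\<^esub> (f y \<ominus>\<^bsub>N\<^esub> g y)"
      using cl by (simp add: module_hom_add[OF f] module_hom_add[OF g] N.M.minus_eq N.M.minus_add N.M.a_ac)
  qed (use cl in \<open>auto simp: module_hom_smult[OF f] module_hom_smult[OF g] N.M.minus_eq
        N.smult_r_distr N.smult_r_minus\<close>)
qed

lemma module_hom_sum:
  assumes "left_module A N" and f: "f \<in> module_hom A M N" and g: "g \<in> module_hom A M N"
  shows "(\<lambda>x. f x \<oplus>\<^bsub>N\<^esub> g x) \<in> module_hom A M N"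
proof -
  interpret N: left_module A N by fact
  note cl = module_hom_closed[OF f] module_hom_closed[OF g]
  show ?thesis
    by (rule module_homI) (use cl in \<open>auto simp: module_hom_smult[OF f] module_hom_smult[OF g]
        module_hom_add[OF f] module_hom_add[OF g] N.M.a_ac N.smult_r_distr\<close>)
qed

lemma module_hom_central_smult:
  assumes "left_module A N" and f: "f \<in> module_hom A M N" and z: "z \<in> carrier A"
    and central: "\<And>a. a \<in> carrier A \<Longrightarrow> z \<otimes>\<^bsub>A\<^esub> a = a \<otimes>\<^bsub>A\<^esub> z"
  shows "(\<lambda>x. z \<odot>\<^bsub>N\<^esub> f x) \<in> module_hom A M N"
proof -
  interpret N: left_module A N by fact
  note cl = module_hom_closed[OF f]
  show ?thesis
  proof (rule module_homI)
    fix a x assume ax: "a \<in> carrier A" "x \<in> carrier M"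
    then have "z \<odot>\<^bsub>N\<^esub> f (a \<odot>\<^bsub>M\<^esub> x) = (z \<otimes>\<^bsub>A\<^esub> a) \<odot>\<^bsub>N\<^esub> f x"
      using cl z by (simp add: module_hom_smult[OF f] N.smult_assoc)
    also have "\<dots> = a \<odot>\<^bsub>N\<^esub> (z \<odot>\<^bsub>N\<^esub> f x)"
      unfolding central[OF ax(1)] using ax cl z by (simp add: N.smult_assoc)
    finally show "z \<odot>\<^bsub>N\<^esub> f (a \<odot>\<^bsub>M\<^esub> x) = a \<odot>\<^bsub>N\<^esub> (z \<odot>\<^bsub>N\<^esub> f x)" .
  qed (use cl z in \<open>auto simp: module_hom_add[OF f] N.smult_r_distr\<close>)
qed

lemma module_hom_inv:
  assumes f: "f \<in> module_hom A M N" and bij: "bij_betw f (carrier M) (carrier N)"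
    and M: "left_module A M"
  obtains g where "g \<in> module_hom A N M" "bij_betw g (carrier N) (carrier M)"
    "\<And>x. x \<in> carrier M \<Longrightarrow> g (f x) = x" "\<And>y. y \<in> carrier N \<Longrightarrow> f (g y) = y"
proof -
  interpret M: left_module A M by fact
  define g where "g = the_inv_into (carrier M) f"
  have inj: "inj_on f (carrier M)" and im: "f ` carrier M = carrier N"
    using bij by (auto simp: bij_betw_def)
  have gf: "g (f x) = x" if "x \<in> carrier M" for x
    using inj that by (simp add: g_def the_inv_into_f_f)
  have fg: "f (g y) = y" if "y \<in> carrier N" for y
    using inj im that by (simp add: g_def f_the_inv_into_f)
  have gcl: "g y \<in> carrier M" if "y \<in> carrier N" for y
    using that gf unfolding im[symmetric] by auto
  have "g \<in> module_hom A N M"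
  proof (rule module_homI)
    fix x y assume "x \<in> carrier N" "y \<in> carrier N"
    then show "g (x \<oplus>\<^bsub>N\<^esub> y) = g x \<oplus>\<^bsub>M\<^esub> g y"
      using module_hom_add[OF f, of "g x" "g y"] gcl gf[of "g x \<oplus>\<^bsub>M\<^esub> g y"] by (simp add: fg)
  next
    fix a x assume "a \<in> carrier A" "x \<in> carrier N"
    then show "g (a \<odot>\<^bsub>N\<^esub> x) = a \<odot>\<^bsub>M\<^esub> g x"
      using module_hom_smult[OF f, of a "g x"] gcl gf[of "a \<odot>\<^bsub>M\<^esub> g x"] by (simp add: fg)
  qed (rule gcl)
  moreover have "bij_betw g (carrier N) (carrier M)"
    using bij by (simp add: g_def bij_betw_the_inv_into)
  ultimately show thesis using gf fg that by blast
qed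

lemma module_isomorphicI:
  "\<lbrakk>f \<in> module_hom A M N; bij_betw f (carrier M) (carrier N)\<rbrakk> \<Longrightarrow> module_isomorphic A M N"
  by (auto simp: module_isomorphic_def module_iso_def)

lemma module_isomorphicE:
  assumes "module_isomorphic A M N" "left_module A M"
  obtains f g where "f \<in> module_hom A M N" "bij_betw f (carrier M) (carrier N)"
    "g \<in> module_hom A N M" "bij_betw g (carrier N) (carrier M)"
    "\<And>x. x \<in> carrier M \<Longrightarrow> g (f x) = x" "\<And>y. y \<in> carrier N \<Longrightarrow> f (g y) = y"
proof -
  obtain f where "f \<in> module_hom A M N" "bij_betw f (carrier M) (carrier N)"
    using assms(1) by (auto simp: module_isomorphic_def module_iso_def)
  then show thesis using that module_hom_inv[OF _ _ assms(2)] by metis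
qed

lemma module_isomorphic_refl: "module_isomorphic A M M"
  by (rule module_isomorphicI[OF module_hom_id]) (auto simp: bij_betw_def)

lemma module_isomorphic_sym:
  "\<lbrakk>module_isomorphic A M N; left_module A M\<rbrakk> \<Longrightarrow> module_isomorphic A N M"
  by (metis module_isomorphicE module_isomorphicI)

lemma module_isomorphic_trans:
  assumes "module_isomorphic A M N" "module_isomorphic A N L"
  shows "module_isomorphic A M L"
proof -
  obtain f g where f: "f \<in> module_hom A M N" "bij_betw f (carrier M) (carrier N)"
    and g: "g \<in> module_hom A N L" "bij_betw g (carrier N) (carrier L)"
    using assms by (auto simp: module_isomorphic_def module_iso_def)
  show ?thesis
    by (rule module_isomorphicI[OF module_hom_comp[OF f(1) g(1)]])
      (use bij_betw_trans[OF f(2) g(2)] in \<open>simp add: comp_def\<close>)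
qed

lemma iso_class_eq_iff:
  assumes "fg_module A X" "fg_module A Y"
  shows "iso_class A X = iso_class A Y \<longleftrightarrow> module_isomorphic A X Y"
proof
  assume "iso_class A X = iso_class A Y"
  then have "Y \<in> iso_class A X"
    using assms module_isomorphic_refl by (auto simp: iso_class_def)
  then show "module_isomorphic A X Y" by (simp add: iso_class_def)
next
  assume XY: "module_isomorphic A X Y"
  then have "module_isomorphic A Y X"
    using assms(1) by (auto intro: module_isomorphic_sym simp: fg_module_def)
  with XY show "iso_class A X = iso_class A Y"
    by (auto simp: iso_class_def intro: module_isomorphic_trans)
qed

text \<open>Both modules are the quotient of \<open>P\<close> by the common kernel.\<close>

lemma isomorphic_if_same_kernel:
  assumes P: "left_module A P" and Y: "left_module A Y" and Z: "left_module A Z"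
    and \<pi>: "\<pi> \<in> module_hom A P Y" "\<pi> ` carrier P = carrier Y"
    and \<theta>: "\<theta> \<in> module_hom A P Z" "\<theta> ` carrier P = carrier Z"
    and ker: "\<And>p. p \<in> carrier P \<Longrightarrow> \<pi> p = \<zero>\<^bsub>Y\<^esub> \<longleftrightarrow> \<theta> p = \<zero>\<^bsub>Z\<^esub>"
  shows "module_isomorphic A Y Z"
proof -
  interpret P: left_module A P by fact
  interpret Y: left_module A Y by fact
  interpret Z: left_module A Z by fact
  note \<pi>cl = module_hom_closed[OF \<pi>(1)] and \<theta>cl = module_hom_closed[OF \<theta>(1)]
  have eq: "\<pi> p = \<pi> q \<longleftrightarrow> \<theta> p = \<theta> q" if "p \<in> carrier P" "q \<in> carrier P" for p q
    using ker[of "p \<ominus>\<^bsub>P\<^esub> q"] that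
    by (simp add: module_hom_minus[OF P Y \<pi>(1)] module_hom_minus[OF P Z \<theta>(1)]
        Y.minus_eq_zero_iff Z.minus_eq_zero_iff \<pi>cl \<theta>cl P.M.minus_closed)
  define s where "s y = (SOME p. p \<in> carrier P \<and> \<pi> p = y)" for y
  have s: "s y \<in> carrier P \<and> \<pi> (s y) = y" if "y \<in> carrier Y" for y
    unfolding s_def by (rule someI_ex) (use that in \<open>auto simp flip: \<pi>(2)\<close>)
  have \<theta>s: "\<theta> (s (\<pi> p)) = \<theta> p" if "p \<in> carrier P" for p
    using s[of "\<pi> p"] eq[of "s (\<pi> p)" p] that \<pi>cl by auto
  show ?thesis
  proof (rule module_isomorphicI)
    show "(\<lambda>y. \<theta> (s y)) \<in> module_hom A Y Z"
    proof (rule module_homI)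
      fix x y assume xy: "x \<in> carrier Y" "y \<in> carrier Y"
      then have "\<pi> (s x \<oplus>\<^bsub>P\<^esub> s y) = x \<oplus>\<^bsub>Y\<^esub> y" using s by (simp add: module_hom_add[OF \<pi>(1)])
      then show "\<theta> (s (x \<oplus>\<^bsub>Y\<^esub> y)) = \<theta> (s x) \<oplus>\<^bsub>Z\<^esub> \<theta> (s y)"
        using \<theta>s[of "s x \<oplus>\<^bsub>P\<^esub> s y"] s xy by (simp add: module_hom_add[OF \<theta>(1)])
    next
      fix a x assume ax: "a \<in> carrier A" "x \<in> carrier Y"
      then have "\<pi> (a \<odot>\<^bsub>P\<^esub> s x) = a \<odot>\<^bsub>Y\<^esub> x" using s by (simp add: module_hom_smult[OF \<pi>(1)])
      then show "\<theta> (s (a \<odot>\<^bsub>Y\<^esub> x)) = a \<odot>\<^bsub>Z\<^esub> \<theta> (s x)"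
        using \<theta>s[of "a \<odot>\<^bsub>P\<^esub> s x"] s ax by (simp add: module_hom_smult[OF \<theta>(1)])
    qed (use s \<theta>cl in auto)
    show "bij_betw (\<lambda>y. \<theta> (s y)) (carrier Y) (carrier Z)"
      unfolding bij_betw_def
    proof
      show "inj_on (\<lambda>y. \<theta> (s y)) (carrier Y)"
        by (rule inj_onI) (metis s eq)
      show "(\<lambda>y. \<theta> (s y)) ` carrier Y = carrier Z"
      proof
        show "carrier Z \<subseteq> (\<lambda>y. \<theta> (s y)) ` carrier Y"
        proof
          fix z assume "z \<in> carrier Z"
          then obtain p where "p \<in> carrier P" "z = \<theta> p" using \<theta>(2) by auto
          then show "z \<in> (\<lambda>y. \<theta> (s y)) ` carrier Y" using \<theta>s \<pi>cl by (intro image_eqI[of _ _ "\<pi> p"]) auto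
        qed
      qed (use s \<theta>cl in auto)
    qed
  qed
qed

section \<open>Descending chains\<close>

definition dcc_below :: "('a, 'k) ring_scheme \<Rightarrow> ('a, 'm, 'l) module_scheme \<Rightarrow> 'm set \<Rightarrow> bool" where
  "dcc_below A M W \<longleftrightarrow>
    (\<forall>U :: nat \<Rightarrow> 'm set. (\<forall>n. submodule (U n) A M \<and> U (Suc n) \<subseteq> U n \<and> U n \<subseteq> W) \<longrightarrow>
      (\<exists>n. \<forall>m\<ge>n. U m = U n))"

text \<open>This is the closure of the artinian modules under extensions, with a cyclic module on top.
  A submodule \<open>U\<close> of \<open>R g + W\<close> is controlled by \<open>U \<inter> W\<close> together with the ideal of those
  coefficients \<open>r\<close> for which \<open>r g\<close> lies in \<open>U\<close> up to an element of \<open>W\<close>; if a larger submodule has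
  the same two invariants, then it is equal to \<open>U\<close>. Commutativity makes this ideal two-sided, as
  the definition of an artinian ring requires.\<close>

lemma dcc_below_adjoin:
  fixes R :: "('a, 'k) ring_scheme" and M :: "('a, 'm, 'l) module_scheme"
  assumes R: "cring R" "artinian_ring R" and M: "left_module R M"
    and W: "submodule W R M" "dcc_below R M W" and g: "g \<in> carrier M"
  defines "V \<equiv> {r \<odot>\<^bsub>M\<^esub> g \<oplus>\<^bsub>M\<^esub> w | r w. r \<in> carrier R \<and> w \<in> W}"
  shows "submodule V R M" "dcc_below R M V" "insert g W \<subseteq> V"
proof -
  interpret R: cring R by fact
  interpret M: left_module R M by fact
  note W' = M.submoduleD[OF W(1)]
  have WM: "w \<in> carrier M" if "w \<in> W" for w using that W'(1) by auto
  have VI: "r \<odot>\<^bsub>M\<^esub> g \<oplus>\<^bsub>M\<^esub> w \<in> V" if "r \<in> carrier R" "w \<in> W" for r w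
    using that by (auto simp: V_def)
  have add: "(r \<odot>\<^bsub>M\<^esub> g \<oplus>\<^bsub>M\<^esub> w) \<oplus>\<^bsub>M\<^esub> (s \<odot>\<^bsub>M\<^esub> g \<oplus>\<^bsub>M\<^esub> v) = (r \<oplus>\<^bsub>R\<^esub> s) \<odot>\<^bsub>M\<^esub> g \<oplus>\<^bsub>M\<^esub> (w \<oplus>\<^bsub>M\<^esub> v)"
    if "r \<in> carrier R" "s \<in> carrier R" "w \<in> carrier M" "v \<in> carrier M" for r s w v
    using that g by (simp add: M.smult_l_distr M.M.a_ac)
  have smult: "a \<odot>\<^bsub>M\<^esub> (r \<odot>\<^bsub>M\<^esub> g \<oplus>\<^bsub>M\<^esub> w) = (a \<otimes>\<^bsub>R\<^esub> r) \<odot>\<^bsub>M\<^esub> g \<oplus>\<^bsub>M\<^esub> a \<odot>\<^bsub>M\<^esub> w"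
    if "r \<in> carrier R" "a \<in> carrier R" "w \<in> carrier M" for r a w
    using that g by (simp add: M.smult_r_distr M.smult_assoc)
  show "insert g W \<subseteq> V"
    using VI[of "\<one>\<^bsub>R\<^esub>" "\<zero>\<^bsub>M\<^esub>"] VI[of "\<zero>\<^bsub>R\<^esub>"] W' g by (auto simp: M.smult_l_null subset_iff)
  show "submodule V R M"
  proof (rule M.submoduleI)
    show "V \<subseteq> carrier M" using W'(1) g by (auto simp: V_def)
    show "\<zero>\<^bsub>M\<^esub> \<in> V" using VI[of "\<zero>\<^bsub>R\<^esub>" "\<zero>\<^bsub>M\<^esub>"] W'(2) g by (simp add: M.smult_l_null)
    fix x y assume "x \<in> V" "y \<in> V"
    then obtain r s w v where "r \<in> carrier R" "w \<in> W" "x = r \<odot>\<^bsub>M\<^esub> g \<oplus>\<^bsub>M\<^esub> w"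
      "s \<in> carrier R" "v \<in> W" "y = s \<odot>\<^bsub>M\<^esub> g \<oplus>\<^bsub>M\<^esub> v" by (auto simp: V_def)
    then show "x \<oplus>\<^bsub>M\<^esub> y \<in> V" by (simp add: add WM VI W'(3))
  next
    fix a x assume a: "a \<in> carrier R" and "x \<in> V"
    then obtain r w where "r \<in> carrier R" "w \<in> W" "x = r \<odot>\<^bsub>M\<^esub> g \<oplus>\<^bsub>M\<^esub> w" by (auto simp: V_def)
    then show "a \<odot>\<^bsub>M\<^esub> x \<in> V" using a by (simp add: smult WM VI W'(4))
  qed
  show "dcc_below R M V"
    unfolding dcc_below_def
  proof (intro allI impI)
    fix U :: "nat \<Rightarrow> 'm set"
    assume U: "\<forall>n. submodule (U n) R M \<and> U (Suc n) \<subseteq> U n \<and> U n \<subseteq> V"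
    then have U': "submodule (U n) R M" "U (Suc n) \<subseteq> U n" "U n \<subseteq> V" for n by auto
    note Un = M.submoduleD[OF U'(1)]
    define I where "I n = {r \<in> carrier R. \<exists>w\<in>W. r \<odot>\<^bsub>M\<^esub> g \<oplus>\<^bsub>M\<^esub> w \<in> U n}" for n
    have "ideal (I n) R" for n
    proof (rule idealI)
      have I_smult: "a \<otimes>\<^bsub>R\<^esub> r \<in> I n" if a: "a \<in> carrier R" and r: "r \<in> I n" for a r
      proof -
        obtain w where w: "w \<in> W" "r \<odot>\<^bsub>M\<^esub> g \<oplus>\<^bsub>M\<^esub> w \<in> U n" "r \<in> carrier R" using r by (auto simp: I_def)
        then have "(a \<otimes>\<^bsub>R\<^esub> r) \<odot>\<^bsub>M\<^esub> g \<oplus>\<^bsub>M\<^esub> a \<odot>\<^bsub>M\<^esub> w \<in> U n"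
          using smult[of r a w] Un(4)[OF a w(2)] WM a by simp
        then show ?thesis using w a W'(4) by (auto simp: I_def)
      qed
      show "a \<otimes>\<^bsub>R\<^esub> r \<in> I n" "r \<otimes>\<^bsub>R\<^esub> a \<in> I n" if "r \<in> I n" "a \<in> carrier R" for r a
        using I_smult[OF that(2,1)] that R.m_comm[of r a] by (auto simp: I_def)
      show "subgroup (I n) (add_monoid R)"
      proof (rule R.add.subgroupI)
        show "I n \<noteq> {}"
          using Un(2)[of n] W'(2) g by (auto simp: I_def M.smult_l_null intro!: exI[of _ "\<zero>\<^bsub>R\<^esub>"] bexI[of _ "\<zero>\<^bsub>M\<^esub>"])
        show "r \<oplus>\<^bsub>R\<^esub> s \<in> I n" if "r \<in> I n" "s \<in> I n" for r s
        proof -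
          obtain w v where wv: "w \<in> W" "r \<odot>\<^bsub>M\<^esub> g \<oplus>\<^bsub>M\<^esub> w \<in> U n" "r \<in> carrier R"
            "v \<in> W" "s \<odot>\<^bsub>M\<^esub> g \<oplus>\<^bsub>M\<^esub> v \<in> U n" "s \<in> carrier R" using \<open>r \<in> I n\<close> \<open>s \<in> I n\<close> by (auto simp: I_def)
          then have "(r \<oplus>\<^bsub>R\<^esub> s) \<odot>\<^bsub>M\<^esub> g \<oplus>\<^bsub>M\<^esub> (w \<oplus>\<^bsub>M\<^esub> v) \<in> U n"
            using add[of r s w v] Un(3)[OF wv(2,5)] WM by simp
          then show ?thesis using wv W'(3) by (auto simp: I_def)
        qed
        show "\<ominus>\<^bsub>R\<^esub> r \<in> I n" if "r \<in> I n" for r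
          using I_smult[of "\<ominus>\<^bsub>R\<^esub> \<one>\<^bsub>R\<^esub>" r] that by (simp add: I_def R.l_minus)
      qed (auto simp: I_def)
    qed (rule R.ring_axioms)
    moreover have "I (Suc n) \<subseteq> I n" for n using U'(2)[of n] by (auto simp: I_def)
    ultimately obtain k where k: "\<And>m. m \<ge> k \<Longrightarrow> I m = I k"
      using R(2) unfolding artinian_ring_def by (metis (no_types))
    have "submodule (U n \<inter> W) R M" for n
      by (rule M.submoduleI) (use Un W' in auto)
    moreover have "U (Suc n) \<inter> W \<subseteq> U n \<inter> W" for n using U'(2)[of n] by auto
    ultimately obtain l where l: "\<And>m. m \<ge> l \<Longrightarrow> U m \<inter> W = U l \<inter> W"
      using W(2)[unfolded dcc_below_def, rule_format, of "\<lambda>n. U n \<inter> W"] by auto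
    have anti: "U m \<subseteq> U n" if "n \<le> m" for m n
      using that by (rule lift_Suc_antimono_le[rotated]) (rule U'(2))
    define N where "N = max k l"
    have "U N \<subseteq> U m" if m: "m \<ge> N" for m
    proof
      fix u assume u: "u \<in> U N"
      then obtain r w where rw: "u = r \<odot>\<^bsub>M\<^esub> g \<oplus>\<^bsub>M\<^esub> w" "r \<in> carrier R" "w \<in> W"
        using U'(3)[of N] by (auto simp: V_def)
      then have "r \<in> I N" using u by (auto simp: I_def)
      then have "r \<in> I m" using k[of N] k[of m] m by (simp add: N_def)
      then obtain v where v: "v \<in> W" "r \<odot>\<^bsub>M\<^esub> g \<oplus>\<^bsub>M\<^esub> v \<in> U m" by (auto simp: I_def)
      have "u \<ominus>\<^bsub>M\<^esub> (r \<odot>\<^bsub>M\<^esub> g \<oplus>\<^bsub>M\<^esub> v) \<in> U N" using Un(5)[OF u] v anti[OF m] by blast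
      moreover have "u \<ominus>\<^bsub>M\<^esub> (r \<odot>\<^bsub>M\<^esub> g \<oplus>\<^bsub>M\<^esub> v) = w \<ominus>\<^bsub>M\<^esub> v"
      proof -
        have c: "w \<in> carrier M" "v \<in> carrier M" "r \<odot>\<^bsub>M\<^esub> g \<in> carrier M" using rw v WM g by auto
        then show ?thesis
          by (simp add: rw(1) M.M.minus_eq M.M.minus_add M.M.a_ac M.M.r_neg M.M.r_neg1)
      qed
      ultimately have "w \<ominus>\<^bsub>M\<^esub> v \<in> U N \<inter> W" using W'(5)[OF rw(3) v(1)] by auto
      then have d: "w \<ominus>\<^bsub>M\<^esub> v \<in> U m" using l[of N] l[of m] m by (auto simp: N_def)
      have "u = (r \<odot>\<^bsub>M\<^esub> g \<oplus>\<^bsub>M\<^esub> v) \<oplus>\<^bsub>M\<^esub> (w \<ominus>\<^bsub>M\<^esub> v)"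
      proof -
        have c: "w \<in> carrier M" "v \<in> carrier M" "r \<odot>\<^bsub>M\<^esub> g \<in> carrier M" using rw v WM g by auto
        then have "v \<oplus>\<^bsub>M\<^esub> (w \<ominus>\<^bsub>M\<^esub> v) = w"
          using M.minus_add_cancel[of w v] by (simp add: M.M.a_comm)
        then show ?thesis using c by (simp add: rw(1) M.M.a_assoc)
      qed
      then show "u \<in> U m" using Un(3)[OF v(2) d] by simp
    qed
    then show "\<exists>n. \<forall>m\<ge>n. U m = U n" using anti by (intro exI[of _ N]) blast
  qed
qed

lemma dcc_below_carrier:
  assumes R: "cring R" "artinian_ring R" and M: "left_module R M" "finitely_generated R M"
  shows "dcc_below R M (carrier M)"
proof -
  interpret M: left_module R M by fact
  obtain S where S: "finite S" "S \<subseteq> carrier M"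
    "\<And>U. submodule U R M \<Longrightarrow> S \<subseteq> U \<Longrightarrow> U = carrier M"
    using M(2) by (auto simp: finitely_generated_def)
  from S(1,2) have "\<exists>W. submodule W R M \<and> dcc_below R M W \<and> S \<subseteq> W"
  proof (induction S)
    case empty
    have "U = {\<zero>\<^bsub>M\<^esub>}" if "submodule U R M" "U \<subseteq> {\<zero>\<^bsub>M\<^esub>}" for U
      using M.submoduleD(2)[OF that(1)] that(2) by auto
    then have "dcc_below R M {\<zero>\<^bsub>M\<^esub>}" unfolding dcc_below_def by metis
    moreover have "submodule {\<zero>\<^bsub>M\<^esub>} R M" by (rule M.submoduleI) (auto simp: M.smult_r_null)
    ultimately show ?case by blast
  next
    case (insert g S)
    then obtain W where W: "submodule W R M" "dcc_below R M W" "S \<subseteq> W" by auto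
    have "g \<in> carrier M" using insert.prems by simp
    note V = dcc_below_adjoin[OF R M(1) W(1,2) this]
    show ?case
      by (intro exI conjI, rule V(1), rule V(2)) (use V(3) W(3) in \<open>auto dest: subsetD\<close>)
  qed
  then show ?thesis using S(3) by metis
qed

text \<open>Scalars act through the structure map \<open>r \<mapsto> r \<odot> \<one>\<close>, whose image is central in \<open>A\<close>.\<close>

definition restrict_scalars :: "('r, 'a) module \<Rightarrow> ('a, 'm, 'l) module_scheme \<Rightarrow> ('r, 'm) module" where
  "restrict_scalars A M =
    \<lparr>carrier = carrier M, mult = mult M, one = one M, zero = zero M, add = add M,
     smult = (\<lambda>r x. (r \<odot>\<^bsub>A\<^esub> \<one>\<^bsub>A\<^esub>) \<odot>\<^bsub>M\<^esub> x)\<rparr>"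

lemma restrict_scalars_simps [simp]:
  "carrier (restrict_scalars A M) = carrier M" "zero (restrict_scalars A M) = zero M"
  "add (restrict_scalars A M) = add M"
  "smult (restrict_scalars A M) r x = (r \<odot>\<^bsub>A\<^esub> \<one>\<^bsub>A\<^esub>) \<odot>\<^bsub>M\<^esub> x"
  by (simp_all add: restrict_scalars_def)

lemma artin_algebraD:
  assumes "artin_algebra R A"
  shows "module R A" "ring A" "cring R" "artinian_ring R" "finitely_generated R A"
    and "\<And>r x y. \<lbrakk>r \<in> carrier R; x \<in> carrier A; y \<in> carrier A\<rbrakk> \<Longrightarrow> (r \<odot>\<^bsub>A\<^esub> x) \<otimes>\<^bsub>A\<^esub> y = r \<odot>\<^bsub>A\<^esub> (x \<otimes>\<^bsub>A\<^esub> y)"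
    and "\<And>r x y. \<lbrakk>r \<in> carrier R; x \<in> carrier A; y \<in> carrier A\<rbrakk> \<Longrightarrow> x \<otimes>\<^bsub>A\<^esub> (r \<odot>\<^bsub>A\<^esub> y) = r \<odot>\<^bsub>A\<^esub> (x \<otimes>\<^bsub>A\<^esub> y)"
  using assms by (auto simp: artin_algebra_def module_def)

lemma artin_algebra_central:
  assumes alg: "artin_algebra R A" and r: "r \<in> carrier R" and a: "a \<in> carrier A"
  shows "(r \<odot>\<^bsub>A\<^esub> \<one>\<^bsub>A\<^esub>) \<otimes>\<^bsub>A\<^esub> a = r \<odot>\<^bsub>A\<^esub> a" "a \<otimes>\<^bsub>A\<^esub> (r \<odot>\<^bsub>A\<^esub> \<one>\<^bsub>A\<^esub>) = r \<odot>\<^bsub>A\<^esub> a"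
proof -
  interpret A: ring A by (rule artin_algebraD[OF alg])
  show "(r \<odot>\<^bsub>A\<^esub> \<one>\<^bsub>A\<^esub>) \<otimes>\<^bsub>A\<^esub> a = r \<odot>\<^bsub>A\<^esub> a" "a \<otimes>\<^bsub>A\<^esub> (r \<odot>\<^bsub>A\<^esub> \<one>\<^bsub>A\<^esub>) = r \<odot>\<^bsub>A\<^esub> a"
    using r a by (simp_all add: artin_algebraD(6,7)[OF alg])
qed

lemma left_module_restrict_scalars:
  assumes alg: "artin_algebra R A" and M: "left_module A M"
  shows "left_module R (restrict_scalars A M)"
proof -
  interpret A: module R A by (rule artin_algebraD[OF alg])
  interpret M: left_module A M by (rule M)
  have one: "r \<odot>\<^bsub>A\<^esub> \<one>\<^bsub>A\<^esub> \<in> carrier A" if "r \<in> carrier R" for r using that by simp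
  have ab: "abelian_group (restrict_scalars A M)"
  proof (rule abelian_groupI, goal_cases)
    case (6 x)
    then show ?case by (intro bexI[of _ "\<ominus>\<^bsub>M\<^esub> x"]) (auto simp: M.M.l_neg)
  qed (auto simp: M.M.a_ac)
  have mult: "(r \<otimes>\<^bsub>R\<^esub> s) \<odot>\<^bsub>A\<^esub> \<one>\<^bsub>A\<^esub> = (r \<odot>\<^bsub>A\<^esub> \<one>\<^bsub>A\<^esub>) \<otimes>\<^bsub>A\<^esub> (s \<odot>\<^bsub>A\<^esub> \<one>\<^bsub>A\<^esub>)"
    if "r \<in> carrier R" "s \<in> carrier R" for r s
    using that one artin_algebra_central(1)[OF alg, of r "s \<odot>\<^bsub>A\<^esub> \<one>\<^bsub>A\<^esub>"] by (simp add: A.smult_assoc1)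
  show ?thesis
    by (intro left_module.intro ab A.R.ring_axioms left_module_axioms.intro)
       (auto simp: M.smult_r_distr A.smult_l_distr M.smult_l_distr mult M.smult_assoc one)
qed

text \<open>Products of generators of \<open>A\<close> over \<open>R\<close> with generators of \<open>M\<close> over \<open>A\<close> generate \<open>M\<close> over \<open>R\<close>.\<close>

lemma finitely_generated_restrict_scalars:
  assumes alg: "artin_algebra R A" and M: "left_module A M" "finitely_generated A M"
  shows "finitely_generated R (restrict_scalars A M)"
proof -
  interpret A: module R A by (rule artin_algebraD[OF alg])
  interpret M: left_module A M by (rule M)
  have RA: "left_module R A"
    by (intro left_module.intro left_module_axioms.intro A.R.ring_axioms A.M.abelian_group_axioms)
      (auto simp: A.smult_l_distr A.smult_r_distr A.smult_assoc1)
  interpret RM: left_module R "restrict_scalars A M" by (rule left_module_restrict_scalars[OF alg M(1)])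
  obtain T where T: "finite T" "T \<subseteq> carrier A"
    "\<And>U. submodule U R A \<Longrightarrow> T \<subseteq> U \<Longrightarrow> U = carrier A"
    using artin_algebraD(5)[OF alg] by (auto simp: finitely_generated_def)
  obtain S where S: "finite S" "S \<subseteq> carrier M"
    "\<And>U. submodule U A M \<Longrightarrow> S \<subseteq> U \<Longrightarrow> U = carrier M"
    using M(2) by (auto simp: finitely_generated_def)
  define Q where "Q = (\<lambda>(t, x). t \<odot>\<^bsub>M\<^esub> x) ` (T \<times> S)"
  have "U = carrier M" if U: "submodule U R (restrict_scalars A M)" and QU: "Q \<subseteq> U" for U
  proof -
    note U' = RM.submoduleD[OF U, simplified]
    have aS: "a \<odot>\<^bsub>M\<^esub> x \<in> U" if x: "x \<in> S" and a: "a \<in> carrier A" for a x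
    proof -
      have xM: "x \<in> carrier M" using x S by auto
      have "submodule {a \<in> carrier A. a \<odot>\<^bsub>M\<^esub> x \<in> U} R A"
      proof (rule left_module.submoduleI[OF RA])
        fix r b assume r: "r \<in> carrier R" and b: "b \<in> {a \<in> carrier A. a \<odot>\<^bsub>M\<^esub> x \<in> U}"
        have "(r \<odot>\<^bsub>A\<^esub> b) \<odot>\<^bsub>M\<^esub> x = (r \<odot>\<^bsub>A\<^esub> \<one>\<^bsub>A\<^esub>) \<odot>\<^bsub>M\<^esub> (b \<odot>\<^bsub>M\<^esub> x)"
          using r b xM artin_algebra_central(1)[OF alg r, of b] by (simp add: M.smult_assoc[symmetric])
        then show "r \<odot>\<^bsub>A\<^esub> b \<in> {a \<in> carrier A. a \<odot>\<^bsub>M\<^esub> x \<in> U}" using U'(4) r b by auto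
      qed (use U' xM in \<open>auto simp: M.smult_l_null M.smult_l_distr\<close>)
      moreover have "T \<subseteq> {a \<in> carrier A. a \<odot>\<^bsub>M\<^esub> x \<in> U}" using T(2) QU x by (auto simp: Q_def)
      ultimately have "{a \<in> carrier A. a \<odot>\<^bsub>M\<^esub> x \<in> U} = carrier A" by (rule T(3))
      then show ?thesis using a by auto
    qed
    have "submodule {y \<in> carrier M. \<forall>a\<in>carrier A. a \<odot>\<^bsub>M\<^esub> y \<in> U} A M"
    proof (rule M.submoduleI)
      fix b y assume "b \<in> carrier A" "y \<in> {y \<in> carrier M. \<forall>a\<in>carrier A. a \<odot>\<^bsub>M\<^esub> y \<in> U}"
      then show "b \<odot>\<^bsub>M\<^esub> y \<in> {y \<in> carrier M. \<forall>a\<in>carrier A. a \<odot>\<^bsub>M\<^esub> y \<in> U}"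
        by (auto simp: M.smult_assoc[symmetric])
    qed (use U' in \<open>auto simp: M.smult_r_null M.smult_r_distr\<close>)
    moreover have "S \<subseteq> {y \<in> carrier M. \<forall>a\<in>carrier A. a \<odot>\<^bsub>M\<^esub> y \<in> U}" using aS S(2) by auto
    ultimately have *: "{y \<in> carrier M. \<forall>a\<in>carrier A. a \<odot>\<^bsub>M\<^esub> y \<in> U} = carrier M" by (rule S(3))
    have "y \<in> U" if "y \<in> carrier M" for y
    proof -
      have "\<one>\<^bsub>A\<^esub> \<odot>\<^bsub>M\<^esub> y \<in> U" using that * M.A.one_closed by blast
      then show ?thesis using that by simp
    qed
    then show ?thesis using U'(1) by auto
  qed
  moreover have "finite Q" "Q \<subseteq> carrier M" using T S by (auto simp: Q_def)
  ultimately show ?thesis unfolding finitely_generated_def by (intro exI[of _ Q]) auto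
qed

section \<open>Endomorphisms of indecomposable modules\<close>

text \<open>Let \<open>B\<close> be the commutant of \<open>f\<close> in the endomorphism ring. The sets \<open>f^n (B x)\<close> form a
  descending chain of \<open>R\<close>-submodules, since \<open>R\<close> acts through the centre of \<open>A\<close> and \<open>B\<close> contains
  \<open>f\<close>. The chain is stationary, so \<open>f^n x\<close>, which lies in the \<open>n\<close>-th set, lies in the next one.\<close>

lemma funpow_eq_at_element:
  assumes alg: "artin_algebra R A" and X: "fg_module A X"
    and f: "f \<in> module_hom A X X" and x: "x \<in> carrier X"
  shows "\<exists>n. \<exists>b\<in>module_hom A X X.
    (\<forall>y\<in>carrier X. b (f y) = f (b y)) \<and> (f ^^ n) x = (f ^^ n) (f (b x))"
proof -
  interpret A: module R A by (rule artin_algebraD[OF alg])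
  have lX: "left_module A X" and fgX: "finitely_generated A X" using X by (auto simp: fg_module_def)
  interpret X: left_module A X by (rule lX)
  interpret RX: left_module R "restrict_scalars A X" by (rule left_module_restrict_scalars[OF alg lX])
  have dcc: "dcc_below R (restrict_scalars A X) (carrier X)"
    using dcc_below_carrier[OF artin_algebraD(3,4)[OF alg] RX.left_module_axioms
        finitely_generated_restrict_scalars[OF alg lX fgX]] by simp
  define B where "B = {b \<in> module_hom A X X. \<forall>y\<in>carrier X. b (f y) = f (b y)}"
  define U where "U n = (\<lambda>b. (f ^^ n) (b x)) ` B" for n
  note fcl = module_hom_closed[OF f] and fn = module_hom_funpow[OF f]
  have fnc: "(f ^^ n) y \<in> carrier X" if "y \<in> carrier X" for n y
    using module_hom_closed[OF fn that] .
  have Bx: "b y \<in> carrier X" if "b \<in> B" "y \<in> carrier X" for b y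
    using that module_hom_closed[of b A X X] by (auto simp: B_def)
  have B_id: "(\<lambda>y. y) \<in> B" by (simp add: B_def module_hom_id)
  have B_f: "(\<lambda>y. f (b y)) \<in> B" if "b \<in> B" for b
    using that module_hom_comp[OF _ f, of b X] by (simp add: B_def)
  have B_add: "(\<lambda>y. b y \<oplus>\<^bsub>X\<^esub> c y) \<in> B" if "b \<in> B" "c \<in> B" for b c
    using that module_hom_sum[OF lX, of b X c] Bx by (simp add: B_def module_hom_add[OF f])
  have B_smult: "(\<lambda>y. (r \<odot>\<^bsub>A\<^esub> \<one>\<^bsub>A\<^esub>) \<odot>\<^bsub>X\<^esub> b y) \<in> B" if "b \<in> B" "r \<in> carrier R" for b r
  proof -
    have r: "r \<odot>\<^bsub>A\<^esub> \<one>\<^bsub>A\<^esub> \<in> carrier A" using that by simp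
    have "(\<lambda>y. (r \<odot>\<^bsub>A\<^esub> \<one>\<^bsub>A\<^esub>) \<odot>\<^bsub>X\<^esub> b y) \<in> module_hom A X X"
      using that artin_algebra_central[OF alg that(2)]
      by (intro module_hom_central_smult[OF lX _ r]) (auto simp: B_def)
    then show ?thesis using that r Bx[OF that(1)] by (simp add: B_def module_hom_smult[OF f])
  qed
  have B_zero: "(\<lambda>y. \<zero>\<^bsub>X\<^esub>) \<in> B"
    using module_hom_zero[OF lX lX f] by (auto simp: B_def X.smult_r_null intro!: module_homI)
  have U_I: "(f ^^ n) (b x) \<in> U n" if "b \<in> B" for b n using that by (auto simp: U_def)
  have "submodule (U n) R (restrict_scalars A X)" for n
  proof (rule RX.submoduleI)
    show "U n \<subseteq> carrier (restrict_scalars A X)" using Bx fnc x by (auto simp: U_def)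
    show "\<zero>\<^bsub>restrict_scalars A X\<^esub> \<in> U n"
      using B_zero module_hom_zero[OF lX lX fn, of n] by (force simp: U_def)
  next
    fix u v assume "u \<in> U n" "v \<in> U n"
    then obtain b c where bc: "b \<in> B" "c \<in> B" "u = (f ^^ n) (b x)" "v = (f ^^ n) (c x)"
      by (auto simp: U_def)
    then have "u \<oplus>\<^bsub>X\<^esub> v = (f ^^ n) (b x \<oplus>\<^bsub>X\<^esub> c x)" using Bx x by (simp add: module_hom_add[OF fn])
    then show "u \<oplus>\<^bsub>restrict_scalars A X\<^esub> v \<in> U n"
      using U_I[OF B_add[OF bc(1,2)], of n] by simp
  next
    fix r u assume r: "r \<in> carrier R" and "u \<in> U n"
    then obtain b where b: "b \<in> B" "u = (f ^^ n) (b x)" by (auto simp: U_def)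
    then have "(r \<odot>\<^bsub>A\<^esub> \<one>\<^bsub>A\<^esub>) \<odot>\<^bsub>X\<^esub> u = (f ^^ n) ((r \<odot>\<^bsub>A\<^esub> \<one>\<^bsub>A\<^esub>) \<odot>\<^bsub>X\<^esub> b x)"
      using Bx x r by (simp add: module_hom_smult[OF fn])
    then show "r \<odot>\<^bsub>restrict_scalars A X\<^esub> u \<in> U n"
      using U_I[OF B_smult[OF b(1) r], of n] by simp
  qed
  moreover have "U (Suc n) \<subseteq> U n" for n
  proof
    fix u assume "u \<in> U (Suc n)"
    then obtain b where "b \<in> B" "u = (f ^^ n) (f (b x))" by (auto simp: U_def funpow_swap1)
    then show "u \<in> U n" using B_f[of b] by (auto simp: U_def)
  qed
  moreover have "U n \<subseteq> carrier X" for n using Bx fnc x by (auto simp: U_def)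
  ultimately obtain n where n: "\<forall>m\<ge>n. U m = U n"
    using dcc[unfolded dcc_below_def, rule_format, of U] by auto
  have "(f ^^ n) x \<in> U n" using B_id by (auto simp: U_def)
  then have "(f ^^ n) x \<in> U (Suc n)" using n[rule_format, of "Suc n"] by simp
  then show ?thesis by (auto simp: U_def funpow_swap1 B_def intro!: exI[of _ n])
qed

text \<open>The elementwise statement amounts to \<open>(1 - f b) f^n x = 0\<close>. A product of such factors, one
  for every generator, kills all generators; commuting with \<open>f\<close>, it has the form \<open>f^m - f^(m+1) c\<close>
  again. The \<open>b\<close> for the next generator \<open>x\<close> is chosen for the image of \<open>x\<close> under the previous
  factors, hence the chosen endomorphisms do not have to commute with each other.\<close>

lemma funpow_eq_everywhere:
  assumes alg: "artin_algebra R A" and X: "fg_module A X" and f: "f \<in> module_hom A X X"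
  shows "\<exists>n. \<exists>b\<in>module_hom A X X. \<forall>y\<in>carrier X.
    b (f y) = f (b y) \<and> (f ^^ n) y = (f ^^ n) (f (b y))"
proof -
  have lX: "left_module A X" using X by (auto simp: fg_module_def)
  interpret X: left_module A X by (rule lX)
  note fcl = module_hom_closed[OF f] and fn = module_hom_funpow[OF f]
  note fncl = module_hom_closed[OF fn]
  have fn_minus: "(f ^^ n) (y \<ominus>\<^bsub>X\<^esub> z) = (f ^^ n) y \<ominus>\<^bsub>X\<^esub> (f ^^ n) z"
    if "y \<in> carrier X" "z \<in> carrier X" for n y z by (rule module_hom_minus[OF lX lX fn that])
  obtain S where S: "finite S" "S \<subseteq> carrier X"
    "\<And>U. submodule U A X \<Longrightarrow> S \<subseteq> U \<Longrightarrow> U = carrier X"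
    using X by (auto simp: finitely_generated_def fg_module_def)
  from S(1,2) have "\<exists>n b. b \<in> module_hom A X X \<and> (\<forall>y\<in>carrier X. b (f y) = f (b y)) \<and>
      (\<forall>y\<in>S. (f ^^ n) y = (f ^^ n) (f (b y)))"
  proof (induction S)
    case empty
    show ?case by (intro exI[of _ 0] exI[of _ "\<lambda>y. y"]) (simp add: module_hom_id)
  next
    case (insert x S)
    then obtain n b where "b \<in> module_hom A X X" "\<forall>y\<in>carrier X. b (f y) = f (b y)"
      "\<forall>y\<in>S. (f ^^ n) y = (f ^^ n) (f (b y))" by auto
    then have b: "b \<in> module_hom A X X" "\<And>y. y \<in> carrier X \<Longrightarrow> b (f y) = f (b y)"
      "\<And>y. y \<in> S \<Longrightarrow> (f ^^ n) y = (f ^^ n) (f (b y))" by auto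
    have x: "x \<in> carrier X" and SX: "S \<subseteq> carrier X" using insert.prems by auto
    note bcl = module_hom_closed[OF b(1)]
    define d where "d y = (f ^^ n) (y \<ominus>\<^bsub>X\<^esub> f (b y))" for y
    have dcl: "d y \<in> carrier X" if "y \<in> carrier X" for y
      using that fncl bcl fcl by (simp add: d_def X.M.minus_closed)
    obtain m c where c: "c \<in> module_hom A X X" "\<And>y. y \<in> carrier X \<Longrightarrow> c (f y) = f (c y)"
      "(f ^^ m) (d x) = (f ^^ m) (f (c (d x)))"
      using funpow_eq_at_element[OF alg X f dcl[OF x]] by metis
    note ccl = module_hom_closed[OF c(1)]
    have comm: "g ((f ^^ k) y) = (f ^^ k) (g y)"
      if "g \<in> module_hom A X X" "\<And>y. y \<in> carrier X \<Longrightarrow> g (f y) = f (g y)" "y \<in> carrier X" for g k y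
      using that fncl by (induction k) auto
    define e where "e y = b y \<oplus>\<^bsub>X\<^esub> c (y \<ominus>\<^bsub>X\<^esub> f (b y))" for y
    have yfb: "(\<lambda>y. y \<ominus>\<^bsub>X\<^esub> f (b y)) \<in> module_hom A X X"
      by (rule module_hom_diff[OF lX module_hom_id module_hom_comp[OF b(1) f]])
    have e: "e \<in> module_hom A X X"
      unfolding e_def by (rule module_hom_sum[OF lX b(1) module_hom_comp[OF yfb c(1)]])
    have ef: "e (f y) = f (e y)" if y: "y \<in> carrier X" for y
    proof -
      have "f y \<ominus>\<^bsub>X\<^esub> f (b (f y)) = f (y \<ominus>\<^bsub>X\<^esub> f (b y))"
        using y fcl bcl by (simp add: b(2) module_hom_minus[OF lX lX f])
      then show ?thesis
        using y fcl bcl ccl module_hom_closed[OF yfb] by (simp add: e_def b(2) c(2) module_hom_add[OF f])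
    qed
    have key: "(f ^^ (n + m)) y \<ominus>\<^bsub>X\<^esub> (f ^^ (n + m)) (f (e y)) = (f ^^ m) (d y) \<ominus>\<^bsub>X\<^esub> (f ^^ m) (f (c (d y)))"
      if y: "y \<in> carrier X" for y
    proof -
      let ?z = "y \<ominus>\<^bsub>X\<^esub> f (b y)"
      have z: "?z \<in> carrier X" using module_hom_closed[OF yfb y] .
      have cl: "f (b y) \<in> carrier X" "f (c ?z) \<in> carrier X" using y z fcl bcl ccl by auto
      have "y \<ominus>\<^bsub>X\<^esub> f (e y) = ?z \<ominus>\<^bsub>X\<^esub> f (c ?z)"
        using y z bcl ccl cl by (simp add: e_def module_hom_add[OF f] X.M.minus_eq X.M.minus_add X.M.a_assoc)
      then have "(f ^^ (n + m)) y \<ominus>\<^bsub>X\<^esub> (f ^^ (n + m)) (f (e y))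
          = (f ^^ (n + m)) ?z \<ominus>\<^bsub>X\<^esub> (f ^^ (n + m)) (f (c ?z))"
        using y z cl module_hom_closed[OF e] fcl by (simp flip: fn_minus)
      also have "(f ^^ (n + m)) ?z = (f ^^ m) (d y)"
        by (simp add: d_def add.commute[of n m] funpow_add)
      also have "(f ^^ (n + m)) (f (c ?z)) = (f ^^ m) (f (c (d y)))"
        using comm[OF c(1,2) z, of n] by (simp add: d_def add.commute[of n m] funpow_add funpow_swap1)
      finally show ?thesis .
    qed
    have eq: "(f ^^ (n + m)) y = (f ^^ (n + m)) (f (e y))"
      if y: "y \<in> carrier X" and d: "(f ^^ m) (d y) = (f ^^ m) (f (c (d y)))" for y
    proof -
      have c0: "(f ^^ m) (f (c (d y))) \<in> carrier X" using y dcl ccl fcl fncl by auto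
      have "(f ^^ (n + m)) y \<ominus>\<^bsub>X\<^esub> (f ^^ (n + m)) (f (e y)) = \<zero>\<^bsub>X\<^esub>"
        unfolding key[OF y] d using c0 by (simp add: X.minus_eq_zero_iff)
      then show ?thesis
        using y module_hom_closed[OF e] fcl fncl by (simp add: X.minus_eq_zero_iff)
    qed
    have "d y = \<zero>\<^bsub>X\<^esub>" if "y \<in> S" for y
      using b(3)[OF that] that SX bcl fcl fncl by (simp add: d_def fn_minus X.minus_eq_zero_iff subset_iff)
    then have "(f ^^ m) (d y) = (f ^^ m) (f (c (d y)))" if "y \<in> S" for y
      using that module_hom_zero[OF lX lX f] module_hom_zero[OF lX lX c(1)] by simp
    then have "\<forall>y\<in>insert x S. (f ^^ (n + m)) y = (f ^^ (n + m)) (f (e y))"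
      using eq c(3) x SX by auto
    then show ?case using e ef by blast
  qed
  then obtain n b where "b \<in> module_hom A X X" "\<forall>y\<in>carrier X. b (f y) = f (b y)"
    "\<forall>y\<in>S. (f ^^ n) y = (f ^^ n) (f (b y))" by auto
  then have b: "b \<in> module_hom A X X" "\<And>y. y \<in> carrier X \<Longrightarrow> b (f y) = f (b y)"
    "\<And>y. y \<in> S \<Longrightarrow> (f ^^ n) y = (f ^^ n) (f (b y))" by auto
  note g = module_hom_comp[OF module_hom_comp[OF b(1) f] fn, of n]
  have "submodule {y \<in> carrier X. (f ^^ n) y = (f ^^ n) (f (b y))} A X"
  proof (rule X.submoduleI)
    show "\<zero>\<^bsub>X\<^esub> \<in> {y \<in> carrier X. (f ^^ n) y = (f ^^ n) (f (b y))}"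
      using module_hom_zero[OF lX lX fn] module_hom_zero[OF lX lX g] by simp
  qed (auto simp: module_hom_add[OF fn] module_hom_add[OF g] module_hom_smult[OF fn] module_hom_smult[OF g])
  then have "{y \<in> carrier X. (f ^^ n) y = (f ^^ n) (f (b y))} = carrier X"
    by (rule S(3)) (use b(3) S(2) in auto)
  then show ?thesis using b(1,2) by (intro exI[of _ n] bexI[of _ b]) auto
qed

text \<open>From \<open>f^n = f^(n+1) b\<close> with \<open>b\<close> commuting with \<open>f\<close> it follows that \<open>f^n = f^(2n) b^n\<close>.
  So \<open>X\<close> is the direct sum of the image and the kernel of \<open>f^n\<close>, and one of them is zero.\<close>

lemma endomorphism_nilpotent_or_bij:
  assumes alg: "artin_algebra R A" and X: "indecomposable_module A X" and f: "f \<in> module_hom A X X"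
  shows "(\<exists>n. \<forall>x\<in>carrier X. (f ^^ n) x = \<zero>\<^bsub>X\<^esub>) \<or> bij_betw f (carrier X) (carrier X)"
proof -
  have fgX: "fg_module A X" using X by (simp add: indecomposable_module_def)
  have lX: "left_module A X" using fgX by (simp add: fg_module_def)
  interpret X: left_module A X by (rule lX)
  obtain n b where b: "b \<in> module_hom A X X" "\<And>y. y \<in> carrier X \<Longrightarrow> b (f y) = f (b y)"
    and fb: "\<And>y. y \<in> carrier X \<Longrightarrow> (f ^^ n) y = (f ^^ n) (f (b y))"
    using funpow_eq_everywhere[OF alg fgX f] by metis
  note fcl = module_hom_closed[OF f] and fn = module_hom_funpow[OF f]
  note fncl = module_hom_closed[OF fn]
  note bcl = module_hom_closed[OF b(1)] and bn = module_hom_funpow[OF b(1)]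
  note bncl = module_hom_closed[OF bn]
  have comm: "g ((h ^^ k) y) = (h ^^ k) (g y)"
    if "h \<in> module_hom A X X" "\<And>y. y \<in> carrier X \<Longrightarrow> g (h y) = h (g y)" "y \<in> carrier X" for g h k y
    using that module_hom_closed[OF module_hom_funpow[OF that(1)]] by (induction k) auto
  have fbn: "(f ^^ n) y = (f ^^ n) ((f ^^ k) ((b ^^ k) y))" if y: "y \<in> carrier X" for k y
  proof (induction k)
    case (Suc k)
    let ?z = "(f ^^ k) ((b ^^ k) y)"
    have z: "?z \<in> carrier X" using y fncl bncl by blast
    have "(f ^^ n) y = (f ^^ n) (f (b ?z))" using Suc fb[OF z] by simp
    also have "b ?z = (f ^^ k) (b ((b ^^ k) y))" by (rule comm[OF f]) (use b y bncl in auto)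
    finally show ?case by simp
  qed simp
  let ?p = "\<lambda>y. (f ^^ n) ((b ^^ n) y)"
  have swap: "(b ^^ n) ((f ^^ n) y) = (f ^^ n) ((b ^^ n) y)" if "y \<in> carrier X" for y
  proof (rule comm[OF f _ that])
    fix z assume z: "z \<in> carrier X"
    show "(b ^^ n) (f z) = f ((b ^^ n) z)"
      by (rule comm[OF b(1) _ z, symmetric]) (simp add: b(2))
  qed
  define U where "U = (f ^^ n) ` carrier X"
  define V where "V = {x \<in> carrier X. (f ^^ n) x = \<zero>\<^bsub>X\<^esub>}"
  have U: "submodule U A X"
  proof (rule X.submoduleI)
    show "U \<subseteq> carrier X" using fncl by (auto simp: U_def)
    show "\<zero>\<^bsub>X\<^esub> \<in> U" using module_hom_zero[OF lX lX fn, of n] by (force simp: U_def)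
    show "x \<oplus>\<^bsub>X\<^esub> y \<in> U" if "x \<in> U" "y \<in> U" for x y
      using that by (auto simp: U_def module_hom_add[OF fn, symmetric])
    show "a \<odot>\<^bsub>X\<^esub> x \<in> U" if "a \<in> carrier A" "x \<in> U" for a x
      using that by (auto simp: U_def module_hom_smult[OF fn, symmetric])
  qed
  have V: "submodule V A X"
    by (rule X.submoduleI) (use module_hom_zero[OF lX lX fn, of n] in
      \<open>auto simp: V_def module_hom_add[OF fn] module_hom_smult[OF fn] X.smult_r_null\<close>)
  have residue: "y \<ominus>\<^bsub>X\<^esub> ?p y \<in> V" if y: "y \<in> carrier X" for y
  proof -
    have py: "?p y \<in> carrier X" using y fncl bncl by blast
    have "(f ^^ n) (y \<ominus>\<^bsub>X\<^esub> ?p y) = (f ^^ n) y \<ominus>\<^bsub>X\<^esub> (f ^^ n) (?p y)"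
      by (rule module_hom_minus[OF lX lX fn y py])
    also have "\<dots> = \<zero>\<^bsub>X\<^esub>"
      using fbn[OF y, of n] y py fncl by (simp add: X.minus_eq_zero_iff)
    finally show ?thesis using y py by (simp add: V_def X.M.minus_closed)
  qed
  have "U <+>\<^bsub>X\<^esub> V = carrier X"
  proof
    show "U <+>\<^bsub>X\<^esub> V \<subseteq> carrier X"
      using X.submoduleD(1)[OF U] X.submoduleD(1)[OF V] by (auto simp: set_add_def')
    show "carrier X \<subseteq> U <+>\<^bsub>X\<^esub> V"
    proof
      fix y assume y: "y \<in> carrier X"
      have py: "?p y \<in> carrier X" using y fncl bncl by blast
      have "y = ?p y \<oplus>\<^bsub>X\<^esub> (y \<ominus>\<^bsub>X\<^esub> ?p y)"
        using X.minus_add_cancel[OF y py] y py by (simp add: X.M.a_comm X.M.minus_closed)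
      moreover have "?p y \<in> U" using bncl[OF y] by (auto simp: U_def)
      ultimately show "y \<in> U <+>\<^bsub>X\<^esub> V" using residue[OF y] unfolding set_add_def' by blast
    qed
  qed
  moreover have "U \<inter> V = {\<zero>\<^bsub>X\<^esub>}"
  proof
    show "U \<inter> V \<subseteq> {\<zero>\<^bsub>X\<^esub>}"
    proof
      fix u assume u: "u \<in> U \<inter> V"
      then obtain y where y: "y \<in> carrier X" "u = (f ^^ n) y" by (auto simp: U_def)
      have u0: "(f ^^ n) u = \<zero>\<^bsub>X\<^esub>" "u \<in> carrier X" using u by (auto simp: V_def)
      have "u = (f ^^ n) ((b ^^ n) u)" using fbn[OF y(1), of n] y swap[OF y(1)] by simp
      also have "\<dots> = (b ^^ n) ((f ^^ n) u)" using swap[OF u0(2)] by simp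
      also have "\<dots> = \<zero>\<^bsub>X\<^esub>" using u0 module_hom_zero[OF lX lX bn] by simp
      finally show "u \<in> {\<zero>\<^bsub>X\<^esub>}" by simp
    qed
  qed (use X.submoduleD(2)[OF U] X.submoduleD(2)[OF V] in auto)
  ultimately consider "U = {\<zero>\<^bsub>X\<^esub>}" | "V = {\<zero>\<^bsub>X\<^esub>}"
    using X U V unfolding indecomposable_module_def by blast
  then show ?thesis
  proof cases
    case 1
    then have "\<forall>x\<in>carrier X. (f ^^ n) x = \<zero>\<^bsub>X\<^esub>" by (auto simp: U_def)
    then show ?thesis by blast
  next
    case 2
    \<comment> \<open>Here \<open>f^n\<close> is injective and may be cancelled: \<open>b\<close> is inverse to \<open>f\<close>.\<close>
    have inv: "f (b y) = y" if y: "y \<in> carrier X" for y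
    proof -
      have fby: "f (b y) \<in> carrier X" using y fcl bcl by blast
      have "(f ^^ n) (y \<ominus>\<^bsub>X\<^esub> f (b y)) = (f ^^ n) y \<ominus>\<^bsub>X\<^esub> (f ^^ n) (f (b y))"
        by (rule module_hom_minus[OF lX lX fn y fby])
      also have "\<dots> = \<zero>\<^bsub>X\<^esub>" using fb[OF y] y fby fncl by (simp add: X.minus_eq_zero_iff)
      finally have "y \<ominus>\<^bsub>X\<^esub> f (b y) \<in> V" using y fby by (simp add: V_def X.M.minus_closed)
      then show ?thesis using 2 y fby by (simp add: X.minus_eq_zero_iff)
    qed
    then have "b (f y) = y" if "y \<in> carrier X" for y using b(2) that by simp
    then have "bij_betw f (carrier X) (carrier X)"
      using inv fcl bcl by (intro bij_betw_byWitness[of _ b]) auto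
    then show ?thesis ..
  qed
qed

text \<open>The endomorphism ring is local: \<open>f\<close> and \<open>f - 1\<close> cannot both be nilpotent. An element of the
  kernel of \<open>f - 1\<close> is fixed by all powers of \<open>f\<close>, so if \<open>f\<close> is nilpotent, then \<open>f - 1\<close> and all of
  its powers are injective.\<close>

lemma endomorphism_bij_or_diff_id_bij:
  assumes alg: "artin_algebra R A" and X: "indecomposable_module A X" and f: "f \<in> module_hom A X X"
  shows "bij_betw f (carrier X) (carrier X) \<or> bij_betw (\<lambda>x. f x \<ominus>\<^bsub>X\<^esub> x) (carrier X) (carrier X)"
proof (rule disjCI)
  let ?s = "\<lambda>x. f x \<ominus>\<^bsub>X\<^esub> x"
  have lX: "left_module A X" using X by (simp add: indecomposable_module_def fg_module_def)
  interpret X: left_module A X by (rule lX)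
  have s: "?s \<in> module_hom A X X" by (rule module_hom_diff[OF lX f module_hom_id])
  note scl = module_hom_closed[OF module_hom_funpow[OF s]]
  assume "\<not> bij_betw ?s (carrier X) (carrier X)"
  then obtain m where m: "\<And>x. x \<in> carrier X \<Longrightarrow> (?s ^^ m) x = \<zero>\<^bsub>X\<^esub>"
    using endomorphism_nilpotent_or_bij[OF alg X s] by auto
  show "bij_betw f (carrier X) (carrier X)"
  proof (rule ccontr)
    assume "\<not> bij_betw f (carrier X) (carrier X)"
    then obtain n where n: "\<And>x. x \<in> carrier X \<Longrightarrow> (f ^^ n) x = \<zero>\<^bsub>X\<^esub>"
      using endomorphism_nilpotent_or_bij[OF alg X f] by auto
    have ker: "x = \<zero>\<^bsub>X\<^esub>" if x: "x \<in> carrier X" and "?s x = \<zero>\<^bsub>X\<^esub>" for x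
    proof -
      have "f x = x" using that module_hom_closed[OF f x] by (simp add: X.minus_eq_zero_iff)
      then have "(f ^^ n) x = x" by (induction n) auto
      then show ?thesis using n[OF x] by simp
    qed
    have "(?s ^^ k) x = \<zero>\<^bsub>X\<^esub> \<Longrightarrow> x = \<zero>\<^bsub>X\<^esub>" if x: "x \<in> carrier X" for k x
    proof (induction k)
      case (Suc k)
      then show ?case using ker[OF scl[OF x, of k]] by simp
    qed simp
    then have "carrier X = {\<zero>\<^bsub>X\<^esub>}" using m X.M.zero_closed by blast
    then show False using X by (simp add: indecomposable_module_def)
  qed
qed

section \<open>The modules \<open>X\<close> and \<open>\<mho>X\<close> determine each other\<close>

lemma projective_module_lift:
  fixes M N :: "'a fgm"
  assumes "projective_module A P" "fg_module A M" "fg_module A N"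
    and "g \<in> module_hom A M N" "g ` carrier M = carrier N" "f \<in> module_hom A P N"
  shows "\<exists>h\<in>module_hom A P M. \<forall>p\<in>carrier P. g (h p) = f p"
  using assms unfolding projective_module_def by blast

lemma left_add_approximation_factor:
  fixes X Q :: "'a fgm"
  assumes "left_add_approximation A X P \<omega>" "projective_module A Q" "f \<in> module_hom A X Q"
  shows "\<exists>g\<in>module_hom A P Q. \<forall>x\<in>carrier X. g (\<omega> x) = f x"
  using assms unfolding left_add_approximation_def by blast

lemma projective_module_retract:
  assumes P: "projective_module A P" and X: "fg_module A X"
    and i: "i \<in> module_hom A X P" and r: "r \<in> module_hom A P X"
    and ri: "\<And>x. x \<in> carrier X \<Longrightarrow> r (i x) = x"
  shows "projective_module A X"
  unfolding projective_module_def
proof (intro conjI allI impI X)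
  fix M N :: "'a fgm" and g f
  assume *: "fg_module A M \<and> fg_module A N \<and> g \<in> module_hom A M N \<and>
    g ` carrier M = carrier N \<and> f \<in> module_hom A X N"
  then have "(\<lambda>p. f (r p)) \<in> module_hom A P N" using module_hom_comp[OF r] by blast
  then obtain h where h: "h \<in> module_hom A P M" "\<And>p. p \<in> carrier P \<Longrightarrow> g (h p) = f (r p)"
    using projective_module_lift[OF P, of M N g "\<lambda>p. f (r p)"] * by auto
  show "\<exists>h\<in>module_hom A X M. \<forall>x\<in>carrier X. g (h x) = f x"
    by (intro bexI[of _ "\<lambda>x. h (i x)"])
      (use module_hom_comp[OF i h(1)] h(2) module_hom_closed[OF i] ri in auto)
qed

lemma quotient_module_hom:
  assumes P: "left_module A P" and U: "submodule U A P"
  defines "q \<equiv> \<lambda>p. U +>\<^bsub>P\<^esub> p"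
  shows "q \<in> module_hom A P (quotient_module P U)"
    and "q ` carrier P = carrier (quotient_module P U)"
    and "\<And>p. p \<in> carrier P \<Longrightarrow> q p = q \<zero>\<^bsub>P\<^esub> \<longleftrightarrow> p \<in> U"
proof -
  interpret P: left_module A P by (rule P)
  note U' = P.submoduleD[OF U]
  have "additive_subgroup U P"
    using U by (simp add: additive_subgroup_def submodule_def)
  then interpret U: abelian_subgroup U P by (rule abelian_subgroupI3) (rule P.M.abelian_group_axioms)
  have mem: "x \<in> q p \<longleftrightarrow> (\<exists>u\<in>U. x = u \<oplus>\<^bsub>P\<^esub> p)" for x p
    by (auto simp: q_def a_r_coset_def')
  have shift: "q (u \<oplus>\<^bsub>P\<^esub> p) = q p" if "u \<in> U" "p \<in> carrier P" for u p
    unfolding q_def by (rule P.M.a_repr_independence[symmetric])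
      (use that U.a_subgroup in \<open>auto simp: a_r_coset_def'\<close>)
  show "q \<in> module_hom A P (quotient_module P U)"
  proof (rule module_homI)
    fix p p' assume "p \<in> carrier P" "p' \<in> carrier P"
    then show "q (p \<oplus>\<^bsub>P\<^esub> p') = q p \<oplus>\<^bsub>quotient_module P U\<^esub> q p'"
      by (simp add: quotient_module_def q_def U.a_rcos_sum)
  next
    fix a p assume ap: "a \<in> carrier A" "p \<in> carrier P"
    have const: "q (a \<odot>\<^bsub>P\<^esub> x) = q (a \<odot>\<^bsub>P\<^esub> p)" if x: "x \<in> q p" for x
    proof -
      obtain u where u: "u \<in> U" "x = u \<oplus>\<^bsub>P\<^esub> p" using x mem[of x p] by auto
      then have "a \<odot>\<^bsub>P\<^esub> x = a \<odot>\<^bsub>P\<^esub> u \<oplus>\<^bsub>P\<^esub> a \<odot>\<^bsub>P\<^esub> p"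
        using ap U'(1) by (auto simp: P.smult_r_distr)
      then show ?thesis using shift[OF U'(4)[OF ap(1) u(1)]] ap by simp
    qed
    have "(\<Union>x\<in>q p. q (a \<odot>\<^bsub>P\<^esub> x)) = (\<Union>x\<in>q p. q (a \<odot>\<^bsub>P\<^esub> p))"
      by (rule SUP_cong[OF refl const])
    moreover have "p \<in> q p" unfolding q_def by (rule U.a_rcos_self[OF ap(2)])
    ultimately have "(\<Union>x\<in>q p. q (a \<odot>\<^bsub>P\<^esub> x)) = q (a \<odot>\<^bsub>P\<^esub> p)" by auto
    then show "q (a \<odot>\<^bsub>P\<^esub> p) = a \<odot>\<^bsub>quotient_module P U\<^esub> q p"
      by (simp add: quotient_module_def q_def)
  qed (auto simp: quotient_module_def q_def A_RCOSETS_def')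
  show "q ` carrier P = carrier (quotient_module P U)"
    by (auto simp: quotient_module_def q_def A_RCOSETS_def')
  show "q p = q \<zero>\<^bsub>P\<^esub> \<longleftrightarrow> p \<in> U" if p: "p \<in> carrier P" for p
  proof
    assume "p \<in> U"
    then show "q p = q \<zero>\<^bsub>P\<^esub>" using shift[of p "\<zero>\<^bsub>P\<^esub>"] p by simp
  next
    assume "q p = q \<zero>\<^bsub>P\<^esub>"
    then have "p \<in> q \<zero>\<^bsub>P\<^esub>" using U.a_rcos_self[OF p] by (simp add: q_def)
    then show "p \<in> U" using mem U'(1) by auto
  qed
qed

lemma image_submodule:
  assumes "left_module A M" "left_module A N" and f: "f \<in> module_hom A M N"
  shows "submodule (f ` carrier M) A N"
proof -
  interpret M: left_module A M by fact
  interpret N: left_module A N by fact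
  show ?thesis
  proof (rule N.submoduleI)
    show "\<zero>\<^bsub>N\<^esub> \<in> f ` carrier M"
      using module_hom_zero[OF assms] by (metis M.M.zero_closed image_eqI)
  qed (use module_hom_closed[OF f] in
      \<open>auto simp flip: module_hom_add[OF f] module_hom_smult[OF f]\<close>)
qed

lemma left_add_approximation_left_module:
  "left_add_approximation A X P \<omega> \<Longrightarrow> left_module A P"
  by (simp add: left_add_approximation_def projective_module_def fg_module_def)

text \<open>The form in which \<open>\<mho>X\<close> is used: instead of a module of cosets, any module \<open>Y\<close> at the right
  end of an exact sequence \<open>X \<rightarrow> P \<rightarrow> Y \<rightarrow> 0\<close> whose first map is a minimal approximation.\<close>

lemma mho_exact_sequence:
  assumes X: "fg_module A X" and Y: "is_mho A X Y"
  shows "\<exists>P \<omega> \<pi>. minimal_left_add_approximation A X P \<omega> \<and>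
    \<pi> \<in> module_hom A P Y \<and> \<pi> ` carrier P = carrier Y \<and>
    (\<forall>p\<in>carrier P. \<pi> p = \<zero>\<^bsub>Y\<^esub> \<longleftrightarrow> p \<in> \<omega> ` carrier X)"
proof -
  obtain P \<omega> \<phi> where min: "minimal_left_add_approximation A X P \<omega>"
    and \<phi>: "\<phi> \<in> module_hom A (quotient_module P (\<omega> ` carrier X)) Y"
      "bij_betw \<phi> (carrier (quotient_module P (\<omega> ` carrier X))) (carrier Y)"
    using Y by (auto simp: is_mho_def module_isomorphic_def module_iso_def)
  then have la: "left_add_approximation A X P \<omega>" by (simp add: minimal_left_add_approximation_def)
  have lX: "left_module A X" and lY: "left_module A Y"
    using X Y by (auto simp: fg_module_def is_mho_def)
  have lP: "left_module A P" by (rule left_add_approximation_left_module[OF la])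
  interpret P: left_module A P by (rule lP)
  have \<omega>: "\<omega> \<in> module_hom A X P" using la by (simp add: left_add_approximation_def)
  define q where "q = (\<lambda>p. (\<omega> ` carrier X) +>\<^bsub>P\<^esub> p)"
  note q = quotient_module_hom[OF lP image_submodule[OF lX lP \<omega>], folded q_def]
  have comp: "(\<lambda>p. \<phi> (q p)) \<in> module_hom A P Y" by (rule module_hom_comp[OF q(1) \<phi>(1)])
  have "\<phi> (q p) = \<zero>\<^bsub>Y\<^esub> \<longleftrightarrow> p \<in> \<omega> ` carrier X" if p: "p \<in> carrier P" for p
  proof -
    have "\<phi> (q \<zero>\<^bsub>P\<^esub>) = \<zero>\<^bsub>Y\<^esub>" by (rule module_hom_zero[OF lP lY comp])
    then have "\<phi> (q p) = \<zero>\<^bsub>Y\<^esub> \<longleftrightarrow> \<phi> (q p) = \<phi> (q \<zero>\<^bsub>P\<^esub>)" by simp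
    also have "\<dots> \<longleftrightarrow> q p = q \<zero>\<^bsub>P\<^esub>"
      using \<phi>(2) module_hom_closed[OF q(1)] p by (auto simp: bij_betw_def inj_on_eq_iff)
    finally show ?thesis using q(3)[OF p] by simp
  qed
  moreover have "(\<lambda>p. \<phi> (q p)) ` carrier P = carrier Y"
    using \<phi>(2) by (simp add: bij_betw_def q(2)[symmetric] image_image)
  ultimately show ?thesis using min comp by blast
qed

text \<open>Factoring each of the two approximations through the other one gives maps in both directions
  whose composites are automorphisms by minimality. The resulting isomorphism \<open>P \<cong> P'\<close> matches the
  images of \<open>X\<close> and \<open>X'\<close>, so the cokernels are isomorphic.\<close>

lemma mho_isomorphic:
  assumes X: "fg_module A X" "fg_module A X'" and iso: "module_isomorphic A X X'"
    and Y: "is_mho A X Y" "is_mho A X' Y'"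
  shows "module_isomorphic A Y Y'"
proof -
  have l: "left_module A X" "left_module A X'" "left_module A Y" "left_module A Y'"
    using X Y by (auto simp: fg_module_def is_mho_def)
  obtain P \<omega> \<pi> where P: "minimal_left_add_approximation A X P \<omega>"
    "\<pi> \<in> module_hom A P Y" "\<pi> ` carrier P = carrier Y"
    "\<And>p. p \<in> carrier P \<Longrightarrow> \<pi> p = \<zero>\<^bsub>Y\<^esub> \<longleftrightarrow> p \<in> \<omega> ` carrier X"
    using mho_exact_sequence[OF X(1) Y(1)] by metis
  obtain P' \<omega>' \<pi>' where P': "minimal_left_add_approximation A X' P' \<omega>'"
    "\<pi>' \<in> module_hom A P' Y'" "\<pi>' ` carrier P' = carrier Y'"
    "\<And>p. p \<in> carrier P' \<Longrightarrow> \<pi>' p = \<zero>\<^bsub>Y'\<^esub> \<longleftrightarrow> p \<in> \<omega>' ` carrier X'"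
    using mho_exact_sequence[OF X(2) Y(2)] by metis
  obtain \<phi> \<psi> where \<phi>: "\<phi> \<in> module_hom A X X'" and \<psi>: "\<psi> \<in> module_hom A X' X"
    and \<psi>\<phi>: "\<And>x. x \<in> carrier X \<Longrightarrow> \<psi> (\<phi> x) = x" and \<phi>\<psi>: "\<And>x. x \<in> carrier X' \<Longrightarrow> \<phi> (\<psi> x) = x"
    using module_isomorphicE[OF iso l(1)] by metis
  note \<phi>cl = module_hom_closed[OF \<phi>] and \<psi>cl = module_hom_closed[OF \<psi>]
  have la: "left_add_approximation A X P \<omega>" "left_add_approximation A X' P' \<omega>'"
    using P(1) P'(1) by (auto simp: minimal_left_add_approximation_def)
  note lP = la[THEN left_add_approximation_left_module]
  have \<omega>: "\<omega> \<in> module_hom A X P" "\<omega>' \<in> module_hom A X' P'"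
    and proj: "projective_module A P" "projective_module A P'"
    using la by (auto simp: left_add_approximation_def)
  note \<omega>cl = module_hom_closed[OF \<omega>(1)] and \<omega>'cl = module_hom_closed[OF \<omega>(2)]
  obtain g where g: "g \<in> module_hom A P P'" "\<And>x. x \<in> carrier X \<Longrightarrow> g (\<omega> x) = \<omega>' (\<phi> x)"
    using left_add_approximation_factor[OF la(1) proj(2) module_hom_comp[OF \<phi> \<omega>(2)]] by auto
  obtain g' where g': "g' \<in> module_hom A P' P" "\<And>x. x \<in> carrier X' \<Longrightarrow> g' (\<omega>' x) = \<omega> (\<psi> x)"
    using left_add_approximation_factor[OF la(2) proj(1) module_hom_comp[OF \<psi> \<omega>(1)]] by auto
  have "(\<lambda>p. g' (g p)) \<in> module_iso A P P"
    using P(1) module_hom_comp[OF g(1) g'(1)] g(2) g'(2) \<phi>cl \<psi>\<phi>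
    by (simp add: minimal_left_add_approximation_def)
  then have inj: "inj_on g (carrier P)"
    by (auto simp: module_iso_def bij_betw_def inj_on_def)
  have "(\<lambda>p. g (g' p)) \<in> module_iso A P' P'"
    using P'(1) module_hom_comp[OF g'(1) g(1)] g(2) g'(2) \<psi>cl \<phi>\<psi>
    by (simp add: minimal_left_add_approximation_def)
  then have "(\<lambda>p. g (g' p)) ` carrier P' = carrier P'"
    by (simp add: module_iso_def bij_betw_def)
  then have surj: "g ` carrier P = carrier P'"
    using module_hom_closed[OF g(1)] module_hom_closed[OF g'(1)] by blast
  show ?thesis
  proof (rule isomorphic_if_same_kernel[OF lP(1) l(3,4) P(2,3) module_hom_comp[OF g(1) P'(2)]])
    show "(\<lambda>p. \<pi>' (g p)) ` carrier P = carrier Y'" using surj P'(3) by (metis image_image)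
    fix p assume p: "p \<in> carrier P"
    have "g p \<in> \<omega>' ` carrier X' \<longleftrightarrow> p \<in> \<omega> ` carrier X"
    proof
      assume "g p \<in> \<omega>' ` carrier X'"
      then obtain x' where x': "x' \<in> carrier X'" "g p = \<omega>' x'" by auto
      then have "g p = g (\<omega> (\<psi> x'))" using g(2) \<psi>cl \<phi>\<psi> by simp
      then have "p = \<omega> (\<psi> x')" using inj p \<omega>cl \<psi>cl x' by (auto dest: inj_onD)
      then show "p \<in> \<omega> ` carrier X" using \<psi>cl x' by auto
    next
      assume "p \<in> \<omega> ` carrier X"
      then show "g p \<in> \<omega>' ` carrier X'" using g(2) \<phi>cl by auto
    qed
    then show "\<pi> p = \<zero>\<^bsub>Y\<^esub> \<longleftrightarrow> \<pi>' (g p) = \<zero>\<^bsub>Y'\<^esub>"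
      using P(4)[OF p] P'(4) module_hom_closed[OF g(1) p] by simp
  qed
qed

text \<open>An embedding of \<open>X\<close> into a projective module factors through \<open>\<omega>\<close>.\<close>

lemma approximation_inj:
  assumes X: "torsionless A X" and la: "left_add_approximation A X P \<omega>"
  shows "inj_on \<omega> (carrier X)"
proof -
  obtain Q f where f: "projective_module A Q" "f \<in> module_hom A X Q" "inj_on f (carrier X)"
    using X by (auto simp: torsionless_def)
  then obtain g where "\<forall>x\<in>carrier X. g (\<omega> x) = f x"
    using left_add_approximation_factor[OF la f(1,2)] by blast
  then show ?thesis by (intro inj_onI) (metis f(3) inj_onD)
qed

lemma hom_factors_through_inj:
  assumes X: "left_module A X" and L: "left_module A L"
    and \<omega>: "\<omega> \<in> module_hom A X P" "inj_on \<omega> (carrier X)"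
    and h: "h \<in> module_hom A L P" "\<And>x. x \<in> carrier L \<Longrightarrow> h x \<in> \<omega> ` carrier X"
  shows "\<exists>u\<in>module_hom A L X. \<forall>x\<in>carrier L. \<omega> (u x) = h x"
proof -
  interpret X: left_module A X by (rule X)
  interpret L: left_module A L by (rule L)
  define u where "u x = the_inv_into (carrier X) \<omega> (h x)" for x
  have \<omega>u: "\<omega> (u x) = h x" if "x \<in> carrier L" for x
    using f_the_inv_into_f[OF \<omega>(2) h(2)[OF that]] by (simp add: u_def)
  have ucl: "u x \<in> carrier X" if "x \<in> carrier L" for x
    using the_inv_into_into[OF \<omega>(2) h(2)[OF that] order_refl] by (simp add: u_def)
  note inj = inj_onD[OF \<omega>(2)]
  have "u \<in> module_hom A L X"
  proof (rule module_homI)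
    fix x y assume xy: "x \<in> carrier L" "y \<in> carrier L"
    show "u (x \<oplus>\<^bsub>L\<^esub> y) = u x \<oplus>\<^bsub>X\<^esub> u y"
      by (rule inj) (use xy ucl in \<open>simp_all add: \<omega>u module_hom_add[OF \<omega>(1)] module_hom_add[OF h(1)]\<close>)
  next
    fix a x assume ax: "a \<in> carrier A" "x \<in> carrier L"
    show "u (a \<odot>\<^bsub>L\<^esub> x) = a \<odot>\<^bsub>X\<^esub> u x"
      by (rule inj) (use ax ucl in \<open>simp_all add: \<omega>u module_hom_smult[OF \<omega>(1)] module_hom_smult[OF h(1)]\<close>)
  qed (rule ucl)
  then show ?thesis using \<omega>u by blast
qed

text \<open>Projectivity of \<open>P\<close> lifts \<open>\<theta>: Y \<rightarrow> Y'\<close> to \<open>g: P \<rightarrow> P'\<close>. As \<open>g\<close> maps the kernel of \<open>\<pi>\<close> into the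
  kernel of \<open>\<pi>'\<close>, which is a copy of \<open>X'\<close>, it restricts to \<open>u: X \<rightarrow> X'\<close>.\<close>

lemma lift_to_syzygies:
  fixes P' Y' :: "'a fgm"
  assumes mod: "fg_module A X'" "fg_module A Y'" "left_module A X" and P: "projective_module A P"
    and P': "fg_module A P'"
    and \<omega>: "\<omega> \<in> module_hom A X P"
    and \<omega>': "\<omega>' \<in> module_hom A X' P'" "inj_on \<omega>' (carrier X')"
    and Y: "left_module A Y"
    and \<pi>: "\<pi> \<in> module_hom A P Y" "\<And>p. p \<in> carrier P \<Longrightarrow> \<pi> p = \<zero>\<^bsub>Y\<^esub> \<longleftrightarrow> p \<in> \<omega> ` carrier X"
    and \<pi>': "\<pi>' \<in> module_hom A P' Y'" "\<pi>' ` carrier P' = carrier Y'"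
      "\<And>p. p \<in> carrier P' \<Longrightarrow> \<pi>' p = \<zero>\<^bsub>Y'\<^esub> \<longleftrightarrow> p \<in> \<omega>' ` carrier X'"
    and \<theta>: "\<theta> \<in> module_hom A Y Y'"
  shows "\<exists>g\<in>module_hom A P P'. \<exists>u\<in>module_hom A X X'.
    (\<forall>p\<in>carrier P. \<pi>' (g p) = \<theta> (\<pi> p)) \<and> (\<forall>x\<in>carrier X. \<omega>' (u x) = g (\<omega> x))"
proof -
  have lX': "left_module A X'" and lY': "left_module A Y'" using mod by (auto simp: fg_module_def)
  obtain g where g: "g \<in> module_hom A P P'" "\<And>p. p \<in> carrier P \<Longrightarrow> \<pi>' (g p) = \<theta> (\<pi> p)"
    using projective_module_lift[OF P P' mod(2) \<pi>'(1,2) module_hom_comp[OF \<pi>(1) \<theta>]] by auto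
  have "g (\<omega> x) \<in> \<omega>' ` carrier X'" if x: "x \<in> carrier X" for x
  proof -
    have \<omega>x: "\<omega> x \<in> carrier P" by (rule module_hom_closed[OF \<omega> x])
    have "\<pi>' (g (\<omega> x)) = \<zero>\<^bsub>Y'\<^esub>"
      using g(2)[OF \<omega>x] \<pi>(2)[OF \<omega>x] x module_hom_zero[OF Y lY' \<theta>] by auto
    then show ?thesis using \<pi>'(3) module_hom_closed[OF g(1) \<omega>x] by blast
  qed
  then have "\<exists>u\<in>module_hom A X X'. \<forall>x\<in>carrier X. \<omega>' (u x) = g (\<omega> x)"
    by (rule hom_factors_through_inj[OF lX' mod(3) \<omega>' module_hom_comp[OF \<omega> g(1)]])
  then show ?thesis using g by blast
qed

text \<open>An endomorphism \<open>f\<close> of \<open>X\<close> that is induced by an endomorphism \<open>g\<close> of \<open>P\<close> over the identity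
  of \<open>Y\<close>: the map \<open>g - 1\<close> has its image in the kernel \<open>X\<close> of \<open>\<pi>\<close>, so \<open>f - 1\<close> factors through \<open>P\<close>.
  If it were bijective, then \<open>X\<close> would be a direct summand of \<open>P\<close> and hence projective.\<close>

lemma induced_endomorphism_bij:
  assumes alg: "artin_algebra R A" and X: "indecomposable_module A X" "\<not> projective_module A X"
    and P: "projective_module A P"
    and \<omega>: "\<omega> \<in> module_hom A X P" "inj_on \<omega> (carrier X)"
    and Y: "left_module A Y"
    and \<pi>: "\<pi> \<in> module_hom A P Y" "\<And>p. p \<in> carrier P \<Longrightarrow> \<pi> p = \<zero>\<^bsub>Y\<^esub> \<longleftrightarrow> p \<in> \<omega> ` carrier X"
    and f: "f \<in> module_hom A X X" and g: "g \<in> module_hom A P P"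
    and \<pi>g: "\<And>p. p \<in> carrier P \<Longrightarrow> \<pi> (g p) = \<pi> p"
    and \<omega>f: "\<And>x. x \<in> carrier X \<Longrightarrow> \<omega> (f x) = g (\<omega> x)"
  shows "bij_betw f (carrier X) (carrier X)"
proof (rule ccontr)
  assume not: "\<not> bij_betw f (carrier X) (carrier X)"
  have fgX: "fg_module A X" using X by (simp add: indecomposable_module_def)
  have lX: "left_module A X" and lP: "left_module A P"
    using fgX P by (auto simp: projective_module_def fg_module_def)
  interpret X: left_module A X by (rule lX)
  interpret P: left_module A P by (rule lP)
  interpret Y: left_module A Y by (rule Y)
  note gcl = module_hom_closed[OF g] and \<omega>cl = module_hom_closed[OF \<omega>(1)]
    and fcl = module_hom_closed[OF f]
  let ?h = "\<lambda>p. g p \<ominus>\<^bsub>P\<^esub> p"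
  have h: "?h \<in> module_hom A P P" by (rule module_hom_diff[OF lP g module_hom_id])
  have "?h p \<in> \<omega> ` carrier X" if p: "p \<in> carrier P" for p
  proof -
    have "\<pi> (?h p) = \<pi> (g p) \<ominus>\<^bsub>Y\<^esub> \<pi> p" by (rule module_hom_minus[OF lP Y \<pi>(1) gcl[OF p] p])
    also have "\<dots> = \<zero>\<^bsub>Y\<^esub>"
      using \<pi>g[OF p] module_hom_closed[OF \<pi>(1) p] by (simp add: Y.minus_eq_zero_iff)
    finally show ?thesis using \<pi>(2) module_hom_closed[OF h p] by blast
  qed
  then obtain s where s: "s \<in> module_hom A P X" "\<And>p. p \<in> carrier P \<Longrightarrow> \<omega> (s p) = ?h p"
    using hom_factors_through_inj[OF lX lP \<omega> h] by metis
  have s\<omega>: "s (\<omega> x) = f x \<ominus>\<^bsub>X\<^esub> x" if x: "x \<in> carrier X" for x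
  proof (rule inj_onD[OF \<omega>(2)])
    show "\<omega> (s (\<omega> x)) = \<omega> (f x \<ominus>\<^bsub>X\<^esub> x)"
      using s(2)[OF \<omega>cl[OF x]] \<omega>f[OF x] module_hom_minus[OF lX lP \<omega>(1) fcl[OF x] x] by simp
  qed (use x \<omega>cl fcl module_hom_closed[OF s(1)] in \<open>auto simp: X.M.minus_closed\<close>)
  have d: "(\<lambda>x. f x \<ominus>\<^bsub>X\<^esub> x) \<in> module_hom A X X" by (rule module_hom_diff[OF lX f module_hom_id])
  have "bij_betw (\<lambda>x. f x \<ominus>\<^bsub>X\<^esub> x) (carrier X) (carrier X)"
    using endomorphism_bij_or_diff_id_bij[OF alg X(1) f] not by simp
  then obtain t where t: "t \<in> module_hom A X X" "\<And>x. x \<in> carrier X \<Longrightarrow> t (f x \<ominus>\<^bsub>X\<^esub> x) = x"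
    using module_hom_inv[OF d _ lX] by metis
  have "projective_module A X"
    by (rule projective_module_retract[OF P fgX \<omega>(1) module_hom_comp[OF s(1) t(1)]])
      (simp add: s\<omega> t(2))
  then show False using X(2) by simp
qed

text \<open>Mutually inverse isomorphisms between \<open>Y\<close> and \<open>Y'\<close> induce maps between \<open>X\<close> and \<open>X'\<close> in both
  directions, and both composites are automorphisms.\<close>

lemma isomorphic_if_mho_isomorphic:
  assumes alg: "artin_algebra R A"
    and X: "indecomposable_module A X" "\<not> projective_module A X" "torsionless A X"
    and X': "indecomposable_module A X'" "\<not> projective_module A X'" "torsionless A X'"
    and Y: "is_mho A X Y" "is_mho A X' Y'" and iso: "module_isomorphic A Y Y'"
  shows "module_isomorphic A X X'"
proof -
  have fg: "fg_module A X" "fg_module A X'" "fg_module A Y" "fg_module A Y'"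
    using X(1) X'(1) Y by (auto simp: indecomposable_module_def is_mho_def)
  then have l: "left_module A X" "left_module A X'" "left_module A Y" "left_module A Y'"
    by (auto simp: fg_module_def)
  obtain P \<omega> \<pi> where P: "minimal_left_add_approximation A X P \<omega>"
    and \<pi>: "\<pi> \<in> module_hom A P Y" "\<pi> ` carrier P = carrier Y"
      "\<And>p. p \<in> carrier P \<Longrightarrow> \<pi> p = \<zero>\<^bsub>Y\<^esub> \<longleftrightarrow> p \<in> \<omega> ` carrier X"
    using mho_exact_sequence[OF fg(1) Y(1)] by metis
  obtain P' \<omega>' \<pi>' where P': "minimal_left_add_approximation A X' P' \<omega>'"
    and \<pi>': "\<pi>' \<in> module_hom A P' Y'" "\<pi>' ` carrier P' = carrier Y'"
      "\<And>p. p \<in> carrier P' \<Longrightarrow> \<pi>' p = \<zero>\<^bsub>Y'\<^esub> \<longleftrightarrow> p \<in> \<omega>' ` carrier X'"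
    using mho_exact_sequence[OF fg(2) Y(2)] by metis
  have la: "left_add_approximation A X P \<omega>" "left_add_approximation A X' P' \<omega>'"
    using P P' by (auto simp: minimal_left_add_approximation_def)
  have \<omega>: "\<omega> \<in> module_hom A X P" "\<omega>' \<in> module_hom A X' P'"
    and proj: "projective_module A P" "projective_module A P'"
    using la by (auto simp: left_add_approximation_def)
  then have fgP: "fg_module A P" "fg_module A P'" by (auto simp: projective_module_def)
  note inj = approximation_inj[OF X(3) la(1)] approximation_inj[OF X'(3) la(2)]
  obtain \<theta> \<eta> where \<theta>: "\<theta> \<in> module_hom A Y Y'" and \<eta>: "\<eta> \<in> module_hom A Y' Y"
    and \<eta>\<theta>: "\<And>y. y \<in> carrier Y \<Longrightarrow> \<eta> (\<theta> y) = y" and \<theta>\<eta>: "\<And>y. y \<in> carrier Y' \<Longrightarrow> \<theta> (\<eta> y) = y"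
    using module_isomorphicE[OF iso l(3)] by metis
  obtain g u where g: "g \<in> module_hom A P P'" "u \<in> module_hom A X X'"
    "\<And>p. p \<in> carrier P \<Longrightarrow> \<pi>' (g p) = \<theta> (\<pi> p)"
    "\<And>x. x \<in> carrier X \<Longrightarrow> \<omega>' (u x) = g (\<omega> x)"
    using lift_to_syzygies[OF fg(2,4) l(1) proj(1) fgP(2) \<omega> inj(2) l(3) \<pi>(1,3) \<pi>' \<theta>] by metis
  obtain g' u' where g': "g' \<in> module_hom A P' P" "u' \<in> module_hom A X' X"
    "\<And>p. p \<in> carrier P' \<Longrightarrow> \<pi> (g' p) = \<eta> (\<pi>' p)"
    "\<And>x. x \<in> carrier X' \<Longrightarrow> \<omega> (u' x) = g' (\<omega>' x)"
    using lift_to_syzygies[OF fg(1,3) l(2) proj(2) fgP(1) \<omega>(2,1) inj(1) l(4) \<pi>'(1,3) \<pi> \<eta>] by metis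
  note cl = module_hom_closed[OF g(1)] module_hom_closed[OF g(2)] module_hom_closed[OF g'(1)]
    module_hom_closed[OF g'(2)] module_hom_closed[OF \<pi>(1)] module_hom_closed[OF \<pi>'(1)]
  have bij: "bij_betw (\<lambda>x. u' (u x)) (carrier X) (carrier X)"
    by (rule induced_endomorphism_bij[OF alg X(1,2) proj(1) \<omega>(1) inj(1) l(3) \<pi>(1,3)
          module_hom_comp[OF g(2) g'(2)] module_hom_comp[OF g(1) g'(1)]])
      (simp_all add: cl g(3,4) g'(3,4) \<eta>\<theta>)
  have bij': "bij_betw (\<lambda>x. u (u' x)) (carrier X') (carrier X')"
    by (rule induced_endomorphism_bij[OF alg X'(1,2) proj(2) \<omega>(2) inj(2) l(4) \<pi>'(1,3)
          module_hom_comp[OF g'(2) g(2)] module_hom_comp[OF g'(1) g(1)]])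
      (simp_all add: cl g(3,4) g'(3,4) \<theta>\<eta>)
  have "inj_on u (carrier X)"
    using bij by (auto simp: bij_betw_def inj_on_def)
  moreover have "u ` carrier X = carrier X'"
  proof
    show "u ` carrier X \<subseteq> carrier X'" using cl by auto
    have "carrier X' = (\<lambda>x. u (u' x)) ` carrier X'" using bij' by (simp add: bij_betw_def)
    also have "\<dots> \<subseteq> u ` carrier X" using cl by auto
    finally show "carrier X' \<subseteq> u ` carrier X" .
  qed
  ultimately show ?thesis using module_isomorphicI[OF g(2)] by (simp add: bij_betw_def)
qed

section \<open>Connected quivers with at most one arrow into and out of each vertex\<close>

lemma single_valued_relpow:
  fixes D :: "('v \<times> 'v) set"
  assumes "single_valued D" "(u, v) \<in> D ^^ n" "(u, w) \<in> D ^^ n"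
  shows "v = w"
  using assms(2,3)
proof (induction n arbitrary: v w)
  case (Suc n)
  then obtain v' w' where "(u, v') \<in> D ^^ n" "(v', v) \<in> D" "(u, w') \<in> D ^^ n" "(w', w) \<in> D" by auto
  with Suc.IH[of v' w'] assms(1) show ?case by (auto dest: single_valuedD)
qed simp

lemma single_valued_converse_relpow:
  fixes D :: "('v \<times> 'v) set"
  assumes "single_valued (D\<inverse>)" "(u, w) \<in> D ^^ n" "(v, w) \<in> D ^^ n"
  shows "u = v"
  using assms(2,3)
proof (induction n arbitrary: w)
  case (Suc n)
  then obtain u' v' where "(u, u') \<in> D ^^ n" "(u', w) \<in> D" "(v, v') \<in> D ^^ n" "(v', w) \<in> D" by auto
  moreover from this have "u' = v'" using assms(1) by (auto dest: single_valuedD)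
  ultimately show ?case using Suc.IH by blast
qed simp

text \<open>Vertices are given integer positions relative to a base vertex \<open>v\<close>; like in
  \<^const>\<open>int_quiver\<close>, the position decreases by one along every arrow.\<close>

definition has_position :: "('v \<times> 'v) set \<Rightarrow> 'v \<Rightarrow> 'v \<Rightarrow> int \<Rightarrow> bool" where
  "has_position D v u z \<longleftrightarrow> (if z \<le> 0 then (v, u) \<in> D ^^ nat (- z) else (u, v) \<in> D ^^ nat z)"

lemma has_position_neg: "has_position D v u (- int n) \<longleftrightarrow> (v, u) \<in> D ^^ n"
  by (simp add: has_position_def)

lemma has_position_pos: "has_position D v u (int n) \<longleftrightarrow> (u, v) \<in> D ^^ n"
  by (cases "n = 0") (auto simp: has_position_def)

lemma has_position_head:
  assumes D: "single_valued D" and u: "has_position D v u z" "(u, w) \<in> D"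
  shows "has_position D v w (z - 1)"
proof (cases "z \<le> 0")
  case True
  then obtain n where n: "z = - int n" by (metis minus_minus nonpos_int_cases)
  then have "(v, w) \<in> D ^^ Suc n" using u by (auto simp: has_position_neg)
  moreover have eq: "z - 1 = - int (Suc n)" by (simp add: n)
  ultimately show ?thesis unfolding eq has_position_neg by simp
next
  case False
  then obtain n where n: "z = int (Suc n)"
    by (metis not_le pos_int_cases Suc_pred)
  then have "(u, v) \<in> D ^^ Suc n" using u(1) by (simp only: has_position_pos)
  then obtain w' where "(u, w') \<in> D" "(w', v) \<in> D ^^ n" by (meson relpow_Suc_D2)
  then have "(w, v) \<in> D ^^ n" using D u(2) by (auto dest: single_valuedD)
  then have "has_position D v w (int n)" by (simp only: has_position_pos)
  then show ?thesis by (simp add: n)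
qed

lemma has_position_tail:
  assumes D: "single_valued (D\<inverse>)" and u: "has_position D v w z" "(u, w) \<in> D"
  shows "has_position D v u (z + 1)"
proof (cases "z < 0")
  case True
  then obtain n where n: "z = - int (Suc n)"
    by (metis neg_int_cases Suc_pred)
  then have "(v, w) \<in> D ^^ Suc n" using u(1) by (simp only: has_position_neg)
  then obtain u' where "(v, u') \<in> D ^^ n" "(u', w) \<in> D" by auto
  then have "(v, u) \<in> D ^^ n" using D u(2) by (auto dest: single_valuedD)
  then have "has_position D v u (- int n)" by (simp only: has_position_neg)
  then show ?thesis by (simp add: n)
next
  case False
  then obtain n where n: "z = int n" by (metis not_less nonneg_int_cases)
  then have "(w, v) \<in> D ^^ n" using u(1) by (simp only: has_position_pos)
  then have "(u, v) \<in> D ^^ Suc n" using u(2) by (meson relpow_Suc_I2)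
  then have "has_position D v u (int (Suc n))" by (simp only: has_position_pos)
  then show ?thesis by (simp add: n algebra_simps)
qed

lemma has_position_inj:
  assumes "single_valued D" "single_valued (D\<inverse>)" "has_position D v u z" "has_position D v w z"
  shows "u = w"
  using assms single_valued_relpow[of D] single_valued_converse_relpow[of D]
  by (auto simp: has_position_def split: if_splits)

lemma relpow_eq_cycle:
  fixes D :: "('v \<times> 'v) set"
  assumes "single_valued D" "(u, v) \<in> D ^^ m" "(u, v) \<in> D ^^ n" "m < n"
  shows "(v, v) \<in> D ^^ (n - m)"
proof -
  have "(u, v) \<in> D ^^ (m + (n - m))" using assms by simp
  then obtain w where "(u, w) \<in> D ^^ m" "(w, v) \<in> D ^^ (n - m)" by (auto simp: relpow_add)
  then show ?thesis using single_valued_relpow[OF assms(1,2)] by blast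
qed

lemma has_position_unique:
  assumes D: "single_valued D" and acyclic: "\<And>u n. (u, u) \<in> D ^^ n \<Longrightarrow> n = 0"
    and u: "has_position D v u z" "has_position D v u z'"
  shows "z = z'"
proof -
  have eq: "m = n" if "(x, y) \<in> D ^^ m" "(x, y) \<in> D ^^ n" for x y m n
    using relpow_eq_cycle[OF D that] relpow_eq_cycle[OF D that(2,1)] acyclic
    by (metis linorder_neqE_nat zero_less_diff less_irrefl)
  have opp: "m = 0 \<and> n = 0" if "(x, y) \<in> D ^^ m" "(y, x) \<in> D ^^ n" for x y m n
    using that acyclic[of x "m + n"] by (auto simp: relpow_add)
  show ?thesis
    using u eq opp by (auto simp: has_position_def split: if_splits) fastforce+
qed

text \<open>In a connected digraph the arcs may be followed in both directions.\<close>

lemma connected_induct: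
  assumes "connected G" and uv: "u \<in> verts G" "v \<in> verts G" and "P u"
    and "\<And>a. \<lbrakk>a \<in> arcs G; P (tail G a)\<rbrakk> \<Longrightarrow> P (head G a)"
    and "\<And>a. \<lbrakk>a \<in> arcs G; P (head G a)\<rbrakk> \<Longrightarrow> P (tail G a)"
  shows "P v"
proof -
  have "(u, v) \<in> rtrancl_on (verts G) (parcs (mk_symmetric G))"
    using assms(1) uv by (simp add: connected_def strongly_connected_def reachable_def)
  then show ?thesis
    by (induction rule: rtrancl_on_induct) (use assms(4-6) in \<open>auto simp: parcs_mk_symmetric\<close>)
qed

lemma digraph_iso_int_quiverI:
  assumes G: "wf_digraph G" and inj: "inj_on h (verts G)" and tail: "inj_on (tail G) (arcs G)"
    and step: "\<And>a. a \<in> arcs G \<Longrightarrow> h (head G a) = h (tail G a) - 1"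
    and arc: "\<And>u v. \<lbrakk>u \<in> verts G; v \<in> verts G; h v = h u - 1\<rbrakk> \<Longrightarrow> \<exists>a\<in>arcs G. tail G a = u"
    and I: "h ` verts G = I"
  shows "digraph_iso G (int_quiver I)"
proof -
  interpret wf_digraph G by (rule G)
  define f :: "('a, 'b, int, int) digraph_isomorphism" where
    "f = \<lparr>iso_verts = h, iso_arcs = (\<lambda>a. h (tail G a)), iso_head = (\<lambda>z. z - 1), iso_tail = (\<lambda>z. z)\<rparr>"
  have "tail G ` arcs G \<subseteq> verts G" by auto
  then have "inj_on (\<lambda>a. h (tail G a)) (arcs G)"
    using comp_inj_on[OF tail inj_on_subset[OF inj]] by (simp add: comp_def)
  then have "digraph_isomorphism f"
    using G inj step by (simp add: digraph_isomorphism_def f_def)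
  moreover have "(\<lambda>a. h (tail G a)) ` arcs G = {z \<in> I. z - 1 \<in> I}"
  proof
    show "(\<lambda>a. h (tail G a)) ` arcs G \<subseteq> {z \<in> I. z - 1 \<in> I}"
      using I step by (auto simp flip: step)
    show "{z \<in> I. z - 1 \<in> I} \<subseteq> (\<lambda>a. h (tail G a)) ` arcs G"
    proof
      fix z assume "z \<in> {z \<in> I. z - 1 \<in> I}"
      then obtain u v where "u \<in> verts G" "v \<in> verts G" "z = h u" "z - 1 = h v" using I by auto
      then show "z \<in> (\<lambda>a. h (tail G a)) ` arcs G" using arc[of u v] by auto
    qed
  qed
  then have "int_quiver I = app_iso f G"
    using I by (simp add: int_quiver_def app_iso_def f_def)
  ultimately show ?thesis unfolding digraph_iso_def by blast
qed

text \<open>A set that contains \<open>0\<close> and is stable under steps towards \<open>0\<close> is an interval. If it is bounded on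
  some side, then it has an end there, which is translated to \<open>1\<close> when there are two ends and to
  \<open>0\<close> when there is one.\<close>

lemma int_interval_shift:
  fixes I :: "int set"
  assumes zero: "0 \<in> I" and down: "\<And>z. \<lbrakk>z \<in> I; 0 < z\<rbrakk> \<Longrightarrow> z - 1 \<in> I"
    and up: "\<And>z. \<lbrakk>z \<in> I; z < 0\<rbrakk> \<Longrightarrow> z + 1 \<in> I"
  obtains c J where "(\<lambda>z. z + c) ` I = J"
    "(\<exists>n\<ge>1. J = {1..int n}) \<or> J = {..0} \<or> J = {0..} \<or> J = UNIV"
proof -
  have pos: "k \<in> I" if "z \<in> I" "0 \<le> k" "k \<le> z" for k z
    using that(3,1,2) by (induction k rule: int_le_induct) (use down in auto)
  have neg: "k \<in> I" if "z \<in> I" "k \<le> 0" "z \<le> k" for k z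
    using that(3,1,2) by (induction k rule: int_ge_induct) (use up in auto)
  have between: "k \<in> I" if "x \<in> I" "y \<in> I" "x \<le> k" "k \<le> y" for k x y
    using pos[of y k] neg[of x k] that by linarith
  have image: "(\<lambda>z. z + c) ` K = {z. z - c \<in> K}" for c :: int and K
    by (auto simp: image_iff) (metis diff_add_cancel)
  consider (bdd) x y where "x \<in> I" "\<forall>z\<in>I. x \<le> z" "y \<in> I" "\<forall>z\<in>I. z \<le> y"
    | (above) y where "\<forall>x. \<exists>z\<in>I. z < x" "y \<in> I" "\<forall>z\<in>I. z \<le> y"
    | (below) x where "x \<in> I" "\<forall>z\<in>I. x \<le> z" "\<forall>y. \<exists>z\<in>I. y < z"
    | (unbdd) "\<forall>x. \<exists>z\<in>I. z < x" "\<forall>y. \<exists>z\<in>I. y < z"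
  proof -
    have min: "\<exists>x\<in>I. \<forall>z\<in>I. x \<le> z" if "\<forall>z\<in>I. b \<le> z" for b
    proof -
      have "finite (I \<inter> {..0})" by (rule finite_subset[of _ "{b..0}"]) (use that in auto)
      then have "Min (I \<inter> {..0}) \<in> I \<inter> {..0}" "\<forall>z\<in>I \<inter> {..0}. Min (I \<inter> {..0}) \<le> z"
        using zero Min_in[of "I \<inter> {..0}"] by auto
      then show ?thesis by (intro bexI[of _ "Min (I \<inter> {..0})"]) force+
    qed
    have max: "\<exists>y\<in>I. \<forall>z\<in>I. z \<le> y" if "\<forall>z\<in>I. z \<le> b" for b
    proof -
      have "finite (I \<inter> {0..})" by (rule finite_subset[of _ "{0..b}"]) (use that in auto)
      then have "Max (I \<inter> {0..}) \<in> I \<inter> {0..}" "\<forall>z\<in>I \<inter> {0..}. z \<le> Max (I \<inter> {0..})"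
        using zero Max_in[of "I \<inter> {0..}"] by auto
      then show ?thesis by (intro bexI[of _ "Max (I \<inter> {0..})"]) force+
    qed
    show thesis
    proof (cases "\<exists>b. \<forall>z\<in>I. b \<le> z")
      case lower: True
      then obtain x where x: "x \<in> I" "\<forall>z\<in>I. x \<le> z" using min by blast
      show thesis
      proof (cases "\<exists>b. \<forall>z\<in>I. z \<le> b")
        case True
        then obtain y where "y \<in> I" "\<forall>z\<in>I. z \<le> y" using max by blast
        then show thesis by (rule bdd[OF x])
      next
        case False
        then have "\<forall>y. \<exists>z\<in>I. y < z" by (meson not_less)
        then show thesis by (rule below[OF x])
      qed
    next
      case False
      then have lower: "\<forall>x. \<exists>z\<in>I. z < x" by (meson not_less)
      show thesis
      proof (cases "\<exists>b. \<forall>z\<in>I. z \<le> b")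
        case True
        then obtain y where "y \<in> I" "\<forall>z\<in>I. z \<le> y" using max by blast
        then show thesis by (rule above[OF lower])
      next
        case False
        then have "\<forall>y. \<exists>z\<in>I. y < z" by (meson not_less)
        then show thesis by (rule unbdd[OF lower])
      qed
    qed
  qed
  then show thesis
  proof cases
    case bdd
    have "{x..y} \<subseteq> I" using between[OF bdd(1,3)] by auto
    moreover have "I \<subseteq> {x..y}" using bdd(2,4) by auto
    ultimately have I: "I = {x..y}" by (rule equalityI[rotated])
    have "x \<le> y" using bdd(1,4) by blast
    then have "(\<lambda>z. z + (1 - x)) ` I = {1..int (nat (y - x + 1))}"
      unfolding image I by auto
    moreover have "nat (y - x + 1) \<ge> 1" using \<open>x \<le> y\<close> by simp
    ultimately show thesis using that by blast
  next
    case above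
    have "k \<in> I" if k: "k \<le> y" for k
    proof -
      obtain x where "x \<in> I" "x < k" using above(1) by blast
      then show ?thesis using between[of x y k] above(2) k by simp
    qed
    then have "{..y} \<subseteq> I" by auto
    moreover have "I \<subseteq> {..y}" using above(3) by auto
    ultimately have "I = {..y}" by (rule equalityI[rotated])
    then have "(\<lambda>z. z + (- y)) ` I = {..0}" unfolding image by auto
    then show thesis using that by blast
  next
    case below
    have "k \<in> I" if k: "x \<le> k" for k
    proof -
      obtain y where "y \<in> I" "k < y" using below(3) by blast
      then show ?thesis using between[of x y k] below(1) k by simp
    qed
    then have "{x..} \<subseteq> I" by auto
    moreover have "I \<subseteq> {x..}" using below(2) by auto
    ultimately have "I = {x..}" by (rule equalityI[rotated])
    then have "(\<lambda>z. z + (- x)) ` I = {0..}" unfolding image by auto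
    then show thesis using that by blast
  next
    case unbdd
    have "k \<in> I" for k
    proof -
      obtain x y where "x \<in> I" "x < k" "y \<in> I" "k < y" using unbdd by blast
      then show ?thesis using between[of x y k] by simp
    qed
    then have "I = UNIV" by auto
    then have "(\<lambda>z. z + 0) ` I = UNIV" by auto
    then show thesis using that by blast
  qed
qed

lemma arcs_ends_single_valued:
  assumes "inj_on (tail G) (arcs G)" "inj_on (head G) (arcs G)"
  shows "single_valued (arcs_ends G)" "single_valued ((arcs_ends G)\<inverse>)"
  using assms by (auto simp: single_valued_def arcs_ends_conv dest: inj_onD)

text \<open>Positions are unique, so a vertex may be identified with its position. The positions form
  an interval.\<close>

lemma acyclic_digraph_iso_int_quiver:
  assumes G: "wf_digraph G" "connected G"
    and inj: "inj_on (tail G) (arcs G)" "inj_on (head G) (arcs G)"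
    and acyclic: "\<And>u n. (u, u) \<in> arcs_ends G ^^ n \<Longrightarrow> n = 0"
  obtains I where "digraph_iso G (int_quiver I)"
    "(\<exists>n\<ge>1. I = {1..int n}) \<or> I = {..0} \<or> I = {0..} \<or> I = UNIV"
proof -
  interpret wf_digraph G by (rule G(1))
  let ?D = "arcs_ends G"
  note D = arcs_ends_single_valued[OF inj]
  have ends: "(tail G a, head G a) \<in> ?D" if "a \<in> arcs G" for a using that by (auto simp: arcs_ends_conv)
  \<comment> \<open>The base vertex of the positions is arbitrary.\<close>
  obtain v where v: "v \<in> verts G" using G(2) by (auto simp: connected_def strongly_connected_def)
  have v0: "has_position ?D v v 0" by (simp add: has_position_def)
  have "\<exists>z. has_position ?D v u z" if "u \<in> verts G" for u
    by (rule connected_induct[OF G(2) v that])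
      (use v0 has_position_head[OF D(1)] has_position_tail[OF D(2)] ends in blast)+
  then obtain h where h: "\<And>u. u \<in> verts G \<Longrightarrow> has_position ?D v u (h u)" by metis
  have h_eq: "h u = z" if "u \<in> verts G" "has_position ?D v u z" for u z
    by (rule has_position_unique[OF D(1) acyclic h[OF that(1)] that(2)])
  have step: "h (head G a) = h (tail G a) - 1" if "a \<in> arcs G" for a
    by (rule h_eq) (use that has_position_head[OF D(1) h ends] in auto)
  have h_inj: "inj_on h (verts G)"
    by (rule inj_onI) (metis h has_position_inj[OF D])
  have out: "\<exists>a\<in>arcs G. tail G a = u" if "u \<in> verts G" and pos: "h u > 0" for u
  proof -
    obtain n where n: "h u = int (Suc n)" using pos by (metis pos_int_cases Suc_pred)
    have "(u, v) \<in> ?D ^^ Suc n" using h[OF that(1)] unfolding n by (simp only: has_position_pos)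
    then obtain w where "(u, w) \<in> ?D" by (meson relpow_Suc_D2)
    then show ?thesis by (auto simp: arcs_ends_conv)
  qed
  have "in": "\<exists>a\<in>arcs G. head G a = u" if "u \<in> verts G" and neg: "h u < 0" for u
  proof -
    obtain n where n: "h u = - int (Suc n)" using neg by (metis neg_int_cases Suc_pred)
    have "(v, u) \<in> ?D ^^ Suc n" using h[OF that(1)] unfolding n by (simp only: has_position_neg)
    then obtain w where "(w, u) \<in> ?D" by auto
    then show ?thesis by (auto simp: arcs_ends_conv)
  qed
  have arc: "\<exists>a\<in>arcs G. tail G a = u" if uw: "u \<in> verts G" "w \<in> verts G" "h w = h u - 1" for u w
  proof (cases "h u > 0")
    case False
    \<comment> \<open>The arrow into \<open>w\<close> starts at the vertex with the position of \<open>u\<close>.\<close>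
    then obtain a where a: "a \<in> arcs G" "head G a = w" using "in"[OF uw(2)] uw(3) by auto
    then have "h (tail G a) = h u" using step[OF a(1)] that(3) by simp
    then have "tail G a = u" using inj_onD[OF h_inj] a(1) that(1) by auto
    then show ?thesis using a(1) by blast
  qed (use out that in blast)
  have h0: "0 \<in> h ` verts G" using h_eq[OF v v0] v by force
  have down: "z - 1 \<in> h ` verts G" if z: "z \<in> h ` verts G" "0 < z" for z
  proof -
    obtain u where u: "u \<in> verts G" "z = h u" using z by auto
    then obtain a where "a \<in> arcs G" "tail G a = u" using out z(2) by auto
    then show ?thesis using step[of a] u by (intro image_eqI[of _ _ "head G a"]) auto
  qed
  have up: "z + 1 \<in> h ` verts G" if z: "z \<in> h ` verts G" "z < 0" for z
  proof -
    obtain u where u: "u \<in> verts G" "z = h u" using z by auto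
    then obtain a where "a \<in> arcs G" "head G a = u" using "in" z(2) by auto
    then show ?thesis using step[of a] u by (intro image_eqI[of _ _ "tail G a"]) auto
  qed
  obtain c J where J: "(\<lambda>z. z + c) ` h ` verts G = J"
    and cases: "(\<exists>n\<ge>1. J = {1..int n}) \<or> J = {..0} \<or> J = {0..} \<or> J = UNIV"
    by (rule int_interval_shift[OF h0 down up])
  have "digraph_iso G (int_quiver J)"
    by (rule digraph_iso_int_quiverI[of _ "\<lambda>u. h u + c", OF G(1) _ inj(1)])
      (use h_inj step arc J in \<open>auto simp: inj_on_def image_image\<close>)
  then show thesis using cases by (rule that)
qed

text \<open>The shortest cycle through \<open>v\<close> is closed under predecessors and successors, hence is
  everything by connectedness.\<close>

lemma cyclic_digraph_iso_cycle_quiver: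
  assumes G: "wf_digraph G" "connected G"
    and inj: "inj_on (tail G) (arcs G)" "inj_on (head G) (arcs G)"
    and cycle: "(v, v) \<in> arcs_ends G ^^ n" "n > 0"
  shows "\<exists>m. digraph_iso G (cycle_quiver m)"
proof -
  interpret wf_digraph G by (rule G(1))
  let ?D = "arcs_ends G"
  note D = arcs_ends_single_valued[OF inj]
  have ends: "(tail G a, head G a) \<in> ?D" if "a \<in> arcs G" for a using that by (auto simp: arcs_ends_conv)
  define k where "k = (LEAST k. k > 0 \<and> (v, v) \<in> ?D ^^ k)"
  have k: "k > 0" "(v, v) \<in> ?D ^^ k"
    using LeastI[of "\<lambda>k. k > 0 \<and> (v, v) \<in> ?D ^^ k" n] cycle by (auto simp: k_def)
  have k_min: "k \<le> j" if "j > 0" "(v, v) \<in> ?D ^^ j" for j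
    using that by (auto simp: k_def intro: Least_le)
  then obtain m where m: "k = Suc m" using k(1) by (cases k) auto
  have v: "v \<in> verts G"
  proof -
    obtain w where "(w, v) \<in> ?D" using k(2) unfolding m by auto
    then show ?thesis by (auto simp: arcs_ends_conv)
  qed
  obtain l where l: "(v, l) \<in> ?D ^^ m" "(l, v) \<in> ?D" using k(2) unfolding m by auto
  have "\<exists>i\<le>m. (v, u) \<in> ?D ^^ i" if "u \<in> verts G" for u
  proof (rule connected_induct[OF G(2) v that])
    show "\<exists>i\<le>m. (v, v) \<in> ?D ^^ i" by (intro exI[of _ 0]) simp
  next
    fix a assume a: "a \<in> arcs G" and "\<exists>i\<le>m. (v, tail G a) \<in> ?D ^^ i"
    then obtain i where i: "i \<le> m" "(v, tail G a) \<in> ?D ^^ i" by auto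
    show "\<exists>i\<le>m. (v, head G a) \<in> ?D ^^ i"
    proof (cases "i = m")
      case True
      then have "tail G a = l" using single_valued_relpow[OF D(1)] i l by blast
      then have "head G a = v" using ends[OF a] l(2) D(1) by (auto dest: single_valuedD)
      then show ?thesis by (intro exI[of _ 0]) simp
    next
      case False
      then show ?thesis using i ends[OF a] by (intro exI[of _ "Suc i"]) auto
    qed
  next
    fix a assume a: "a \<in> arcs G" and "\<exists>i\<le>m. (v, head G a) \<in> ?D ^^ i"
    then obtain i where i: "i \<le> m" "(v, head G a) \<in> ?D ^^ i" by auto
    show "\<exists>i\<le>m. (v, tail G a) \<in> ?D ^^ i"
    proof (cases i)
      case 0
      then have "tail G a = l" using i ends[OF a] l(2) D(2) by (auto dest: single_valuedD)
      then show ?thesis using l(1) by blast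
    next
      case (Suc j)
      then obtain u where "(v, u) \<in> ?D ^^ j" "(u, head G a) \<in> ?D" using i by auto
      moreover from this have "tail G a = u" using ends[OF a] D(2) by (auto dest: single_valuedD)
      ultimately show ?thesis using i Suc by (intro exI[of _ j]) auto
    qed
  qed
  then obtain h where h: "\<And>u. u \<in> verts G \<Longrightarrow> h u \<le> m \<and> (v, u) \<in> ?D ^^ h u" by metis
  have less: False if ij: "i < j" "j \<le> m" "(v, u) \<in> ?D ^^ i" "(v, u) \<in> ?D ^^ j" for i j u
  proof -
    have "(v, u) \<in> ?D ^^ (j - i + i)" using ij by simp
    then obtain w where w: "(v, w) \<in> ?D ^^ (j - i)" "(w, u) \<in> ?D ^^ i" by (auto simp only: relpow_add)
    then have "w = v" using single_valued_converse_relpow[OF D(2) _ ij(3)] by blast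
    then have "k \<le> j - i" using w(1) ij by (intro k_min) auto
    then show False using ij m by simp
  qed
  have h_eq: "h u = i" if "u \<in> verts G" "i \<le> m" "(v, u) \<in> ?D ^^ i" for u i
    using less[of i "h u" u] less[of "h u" i u] h[OF that(1)] that(2,3) by (metis linorder_neqE_nat)
  have h_inj: "inj_on h (verts G)"
    by (rule inj_onI) (metis h single_valued_relpow[OF D(1)])
  have step: "h (head G a) = (h (tail G a) + 1) mod (m + 1)" if a: "a \<in> arcs G" for a
  proof (cases "h (tail G a) = m")
    case True
    then have "tail G a = l" using single_valued_relpow[OF D(1)] h[of "tail G a"] a l(1) by auto
    then have "head G a = v" using ends[OF a] l(2) D(1) by (auto dest: single_valuedD)
    then show ?thesis using True h_eq[OF v, of 0] by simp
  next
    case False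
    have t: "h (tail G a) \<le> m" "(v, tail G a) \<in> ?D ^^ h (tail G a)" using h[of "tail G a"] a by auto
    then have "(v, head G a) \<in> ?D ^^ Suc (h (tail G a))" using ends[OF a] by auto
    then have "h (head G a) = Suc (h (tail G a))" using t False a by (intro h_eq) auto
    then show ?thesis using t False by simp
  qed
  have onto: "\<exists>a\<in>arcs G. h (tail G a) = i" if i: "i \<le> m" for i
  proof -
    have "i + Suc (m - i) = k" using i by (simp add: m)
    then have "(v, v) \<in> ?D ^^ (i + Suc (m - i))" using k(2) by simp
    then obtain u where u: "(v, u) \<in> ?D ^^ i" "(u, v) \<in> ?D ^^ Suc (m - i)" by (auto simp only: relpow_add)
    then obtain w where "(u, w) \<in> ?D" by (meson relpow_Suc_D2)
    then obtain a where a: "a \<in> arcs G" "tail G a = u" by (auto simp: arcs_ends_conv)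
    then have "h u = i" using u(1) i by (intro h_eq) auto
    then show ?thesis using a by blast
  qed
  define f :: "('a, 'b, nat, nat) digraph_isomorphism" where
    "f = \<lparr>iso_verts = h, iso_arcs = (\<lambda>a. h (tail G a)), iso_head = (\<lambda>i. (i + 1) mod (m + 1)),
      iso_tail = (\<lambda>i. i)\<rparr>"
  have "tail G ` arcs G \<subseteq> verts G" by auto
  then have "inj_on (\<lambda>a. h (tail G a)) (arcs G)"
    using comp_inj_on[OF inj(1) inj_on_subset[OF h_inj]] by (simp add: comp_def)
  then have "digraph_isomorphism f"
    using G h_inj step by (simp add: digraph_isomorphism_def f_def)
  moreover have "(\<lambda>a. h (tail G a)) ` arcs G = {0..m}" using onto h by force
  moreover have "h ` verts G = {0..m}"
  proof
    show "{0..m} \<subseteq> h ` verts G" using onto tail_in_verts by force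
  qed (use h in auto)
  ultimately show ?thesis
    unfolding digraph_iso_def cycle_quiver_def app_iso_def
    by (intro exI[of _ m] exI[of _ f]) (simp add: f_def)
qed

section \<open>The components of the \<open>\<mho>\<close>-quiver\<close>

lemma mho_quiver_head_inj:
  "inj_on (head (mho_quiver A)) (arcs (mho_quiver A))"
proof (rule inj_onI)
  fix a b assume ab: "a \<in> arcs (mho_quiver A)" "b \<in> arcs (mho_quiver A)"
    and eq: "head (mho_quiver A) a = head (mho_quiver A) b"
  obtain X Y where a: "a = (iso_class A Y, iso_class A X)" "indecomposable_module A X" "is_mho A X Y"
    using ab(1) by (auto simp: mho_quiver_def)
  obtain X' Y' where b: "b = (iso_class A Y', iso_class A X')" "indecomposable_module A X'" "is_mho A X' Y'"
    using ab(2) by (auto simp: mho_quiver_def)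
  have fg: "fg_module A X" "fg_module A X'" "fg_module A Y" "fg_module A Y'"
    using a b by (auto simp: indecomposable_module_def is_mho_def)
  have "module_isomorphic A X X'" using eq a(1) b(1) fg by (simp add: mho_quiver_def iso_class_eq_iff)
  then have "module_isomorphic A Y Y'" by (rule mho_isomorphic[OF fg(1,2) _ a(3) b(3)])
  then have "iso_class A Y = iso_class A Y'" using fg by (simp add: iso_class_eq_iff)
  then show "a = b" using eq a(1) b(1) by (simp add: mho_quiver_def)
qed

lemma mho_quiver_tail_inj:
  assumes alg: "artin_algebra R A"
  shows "inj_on (tail (mho_quiver A)) (arcs (mho_quiver A))"
proof (rule inj_onI)
  fix a b assume ab: "a \<in> arcs (mho_quiver A)" "b \<in> arcs (mho_quiver A)"
    and eq: "tail (mho_quiver A) a = tail (mho_quiver A) b"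
  obtain X Y where a: "a = (iso_class A Y, iso_class A X)"
    "indecomposable_module A X" "\<not> projective_module A X" "torsionless A X" "is_mho A X Y"
    using ab(1) by (auto simp: mho_quiver_def)
  obtain X' Y' where b: "b = (iso_class A Y', iso_class A X')"
    "indecomposable_module A X'" "\<not> projective_module A X'" "torsionless A X'" "is_mho A X' Y'"
    using ab(2) by (auto simp: mho_quiver_def)
  have fg: "fg_module A X" "fg_module A X'" "fg_module A Y" "fg_module A Y'"
    using a b by (auto simp: indecomposable_module_def is_mho_def)
  have "module_isomorphic A Y Y'" using eq a(1) b(1) fg by (simp add: mho_quiver_def iso_class_eq_iff)
  then have "module_isomorphic A X X'"
    by (rule isomorphic_if_mho_isomorphic[OF alg a(2-4) b(2-4) a(5) b(5)])
  then have "iso_class A X = iso_class A X'" using fg by (simp add: iso_class_eq_iff)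
  then show "a = b" using eq a(1) b(1) by (simp add: mho_quiver_def)
qed

theorem proposition1p5:
  fixes R :: "('r, 'k) ring_scheme" and A :: "('r, 'a) module"
    and C :: "('a fgm set, 'a fgm set \<times> 'a fgm set) pre_digraph"
  assumes "artin_algebra R A"
    and "connected_component (mho_quiver A) C"
  shows "(\<exists>n\<ge>1. digraph_iso C (int_quiver {1..int n})) \<or>
    (\<exists>n. digraph_iso C (cycle_quiver n)) \<or>
    digraph_iso C (int_quiver {..0}) \<or>
    digraph_iso C (int_quiver {0..}) \<or>
    digraph_iso C (int_quiver UNIV)"
proof -
  have sub: "subgraph C (mho_quiver A)" and conn: "connected C"
    using assms(2) by (auto simp: connected_component_def pre_digraph.max_subgraph_def)
  have wf: "wf_digraph C" and arcs: "arcs C \<subseteq> arcs (mho_quiver A)"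
    and ends: "tail C = tail (mho_quiver A)" "head C = head (mho_quiver A)"
    using sub by (auto simp: subgraph_def compatible_def)
  have inj: "inj_on (tail C) (arcs C)" "inj_on (head C) (arcs C)"
    unfolding ends
    using inj_on_subset[OF mho_quiver_tail_inj[OF assms(1)] arcs]
      inj_on_subset[OF mho_quiver_head_inj arcs] by auto
  show ?thesis
  proof (cases "\<exists>u n. (u, u) \<in> arcs_ends C ^^ n \<and> n > 0")
    case True
    then show ?thesis using cyclic_digraph_iso_cycle_quiver[OF wf conn inj] by blast
  next
    case False
    then have acyclic: "n = 0" if "(u, u) \<in> arcs_ends C ^^ n" for u n using that by auto
    obtain I where "digraph_iso C (int_quiver I)"
      "(\<exists>n\<ge>1. I = {1..int n}) \<or> I = {..0} \<or> I = {0..} \<or> I = UNIV"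
      by (rule acyclic_digraph_iso_int_quiver[OF wf conn inj acyclic])
    then show ?thesis by auto
  qed
qed

end
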